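(* Let $2\le s\le s'$ be integers. There is a constant $c=c(s,s')>0$ such that every $K_{s,s'}$-free graph $G$ with average degree $r$ contains a minor with average degree at least $c\,r^{1+\frac{1}{2(s-1)}}$.
   Context: All graphs are finite, simple. $K_{s,s'}$ is the complete bipartite graph with parts of sizes $s$ and $s'$; $G$ is $K_{s,s'}$-free if it has no subgraph isomorphic to $K_{s,s'}$. The average degree of $G$ is $2|E(G)|/|V(G)|$. A graph $\Gamma$ is a minor of $G$ if there are vertex-disjoint connected subgraphs $G_u\subseteq G$, $u\in V(\Gamma)$, with an edge of $G$ between $G_u$ and $G_{u'}$ whenever $uu'\in E(\Gamma)$. *)

theory Defs
  imports Complex_Main "Graph_Theory.Graph_Theory"
begin

text \<open>
  A finite simple graph is a \<^locale>\<open>pair_graph\<close>: a finite loop-free symmetric digraph without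
  parallel arcs, in which every undirected edge \<open>uv\<close> appears as the two arcs \<open>(u, v)\<close> and \<open>(v, u)\<close>.
\<close>

definition edges :: "'a pair_pre_digraph \<Rightarrow> 'a set set" where
  "edges G = {{u, v} | u v. (u, v) \<in> parcs G}"

definition average_degree :: "'a pair_pre_digraph \<Rightarrow> real" where
  "average_degree G = 2 * real (card (edges G)) / real (card (pverts G))"

text \<open>
  The library predicate \<open>K\<^bsub>m,n\<^esub> H\<close> says that \<open>H\<close> itself is a complete bipartite graph with parts of
  sizes \<open>m\<close> and \<open>n\<close>, so it already covers the isomorphism in ``subgraph isomorphic to''.
\<close>

definition complete_bipartite_free :: "nat \<Rightarrow> nat \<Rightarrow> 'a pair_pre_digraph \<Rightarrow> bool" where
  "complete_bipartite_free m n G \<longleftrightarrow>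
     \<not> (\<exists>H :: 'a pair_pre_digraph. subgraph (with_proj H) (with_proj G)
          \<and> complete_bipartite_digraph m n (with_proj H))"

text \<open>
  Connectedness here is the graph-theoretic one, not the topological one; it includes
  nonemptiness of the vertex set.
\<close>

definition is_minor :: "'b pair_pre_digraph \<Rightarrow> 'a pair_pre_digraph \<Rightarrow> bool" where
  "is_minor \<Gamma> G \<longleftrightarrow>
     (\<exists>B :: 'b \<Rightarrow> 'a pair_pre_digraph.
        (\<forall>u \<in> pverts \<Gamma>. pair_graph (B u) \<and> subgraph (with_proj (B u)) (with_proj G)
           \<and> Digraph_Component.connected (with_proj (B u))) \<and>
        (\<forall>u \<in> pverts \<Gamma>. \<forall>u' \<in> pverts \<Gamma>. u \<noteq> u' \<longrightarrow> pverts (B u) \<inter> pverts (B u') = {}) \<and>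
        (\<forall>(u, u') \<in> parcs \<Gamma>. \<exists>x \<in> pverts (B u). \<exists>y \<in> pverts (B u'). (x, y) \<in> parcs G))"

end

theory Submission
  imports Defs "HOL-Library.Disjoint_Sets"
begin

text \<open>
  Passing to a large cut and deleting vertices of low degree gives a bipartite subgraph with parts
  \<open>X\<close> and \<open>Y\<close>, \<open>|Y| \<le> |X|\<close>, all degrees at least \<open>2 * d\<close> where \<open>d\<close> is of order \<open>r\<close>. Put
  \<open>m \<approx> d powr (1 / (2 * (s - 1)))\<close> up to a constant. The minor is obtained by contracting disjoint
  stars. Pack greedily stars with centres in \<open>Y\<close> and \<open>40 * m\<close> leaves in \<open>X\<close>, and let \<open>Z\<close> be the set of
  their centres. By the double counting of Kovari, Sos and Turan, the leaves of one star have of order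
  \<open>m * d\<close> distinct neighbours.

  If many vertices of \<open>X\<close> send half of their edges to \<open>Z\<close>, then \<open>Z\<close> is much smaller than the set of
  these vertices, and contracting stars with \<open>m\<close> leaves onto a subset of \<open>Z\<close> gives average degree of
  order \<open>m * d\<close>. Otherwise there are of order \<open>|X| / m\<close> stars, most of whose edges go to \<open>Y - Z\<close>. Then
  \<open>Y - Z\<close> is itself contracted onto a random set of about \<open>|X| / (40 * m)\<close> centres in \<open>X\<close>, each vertex
  choosing a random neighbouring centre. If \<open>T\<close> is a set of neighbours of one star, the expected
  number of pairs of \<open>T\<close> that collide is governed by the sum of \<open>n e ^ 2\<close> over \<open>e\<close> in \<open>X\<close>, where
  \<open>n e\<close> is the sum of the inverse degrees of the vertices of \<open>T\<close> adjacent to \<open>e\<close>; splitting at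
  \<open>n e = 1 / (5120 * m)\<close> and double counting \<open>s\<close>-subsets of \<open>T\<close> shows that it is at most a small
  multiple of \<open>|T|\<close>, precisely because \<open>m ^ (2 * (s - 1))\<close> is at most a small multiple of \<open>d\<close>.
  All random choices are derandomised by averaging.
\<close>

subsection \<open>Averaging and greedy choices\<close>

lemma exists_le_average:
  fixes f :: "'a \<Rightarrow> real"
  assumes "finite L" "L \<noteq> {}"
  shows "\<exists>e\<in>L. f e \<le> (\<Sum>e\<in>L. f e) / card L"
proof (rule ccontr)
  assume "\<not> ?thesis"
  then have "(\<Sum>e\<in>L. (\<Sum>e\<in>L. f e) / card L) < (\<Sum>e\<in>L. f e)"
    using assms by (intro sum_strict_mono) auto
  then show False
    using assms by simp
qed

lemma sum_off_diagonal_insert: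
  fixes F :: "'a \<Rightarrow> 'a \<Rightarrow> real"
  assumes "finite A" "a \<notin> A"
  shows "(\<Sum>y\<in>insert a A. \<Sum>y'\<in>insert a A - {y}. F y y')
    = (\<Sum>y\<in>A. \<Sum>y'\<in>A - {y}. F y y') + (\<Sum>y\<in>A. F y a + F a y)"
proof -
  have "(\<Sum>y'\<in>insert a A - {y}. F y y') = F y a + (\<Sum>y'\<in>A - {y}. F y y')" if "y \<in> A" for y
  proof -
    have "insert a A - {y} = insert a (A - {y})"
      using that assms by auto
    then show ?thesis
      using assms by simp
  qed
  moreover have "insert a A - {a} = A"
    using assms by auto
  ultimately show ?thesis
    using assms by (simp add: sum.distrib)
qed

text \<open>The right-hand side is the expectation of the left-hand side when the values \<open>g y\<close> are chosen
  independently and uniformly from \<open>L y\<close>.\<close>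

lemma averaging_choice:
  fixes \<kappa> :: "'a \<Rightarrow> 'a \<Rightarrow> real" and u :: "'a \<Rightarrow> 'b \<Rightarrow> real"
  assumes "finite A" "\<And>y. y \<in> A \<Longrightarrow> finite (L y) \<and> L y \<noteq> {}"
  shows "\<exists>g. (\<forall>y\<in>A. g y \<in> L y) \<and>
    (\<Sum>y\<in>A. u y (g y)) + (\<Sum>y\<in>A. \<Sum>y'\<in>A - {y}. \<kappa> y y' * of_bool (g y = g y'))
    \<le> (\<Sum>y\<in>A. (\<Sum>e\<in>L y. u y e) / card (L y))
      + (\<Sum>y\<in>A. \<Sum>y'\<in>A - {y}. \<kappa> y y' * (card (L y \<inter> L y') / (card (L y) * card (L y'))))"
  using assms
proof (induction A arbitrary: u rule: finite_induct)
  case empty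
  then show ?case by simp
next
  case (insert a A)
  \<comment> \<open>Method of conditional expectations: \<open>h e\<close> is the expected value of
    all terms involving \<open>a\<close> once \<open>g a = e\<close> is fixed and the other values
    are still random. \<open>w\<close> merges the two orders of a pair.\<close>
  define w where "w y = \<kappa> y a + \<kappa> a y" for y
  define h where "h e = u a e + (\<Sum>y\<in>A. w y * of_bool (e \<in> L y) / card (L y))" for e
  have La: "finite (L a)" "L a \<noteq> {}"
    using insert.prems by auto
  obtain e0 where e0: "e0 \<in> L a" "h e0 \<le> (\<Sum>e\<in>L a. h e) / card (L a)"
    using exists_le_average[OF La] by blast
  have "(\<Sum>e\<in>L a. \<Sum>y\<in>A. w y * of_bool (e \<in> L y) / card (L y))
      = (\<Sum>y\<in>A. w y * card (L a \<inter> L y) / card (L y))"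
  proof (subst sum.swap, rule sum.cong[OF refl])
    fix y
    have "(\<Sum>e\<in>L a. of_bool (e \<in> L y) :: real) = card (L a \<inter> L y)"
      using La by simp
    then show "(\<Sum>e\<in>L a. w y * of_bool (e \<in> L y) / card (L y)) = w y * card (L a \<inter> L y) / card (L y)"
      by (simp flip: sum_distrib_left sum_divide_distrib)
  qed
  then have havg: "(\<Sum>e\<in>L a. h e) / card (L a)
      = (\<Sum>e\<in>L a. u a e) / card (L a) + (\<Sum>y\<in>A. w y * (card (L a \<inter> L y) / (card (L a) * card (L y))))"
    by (simp add: h_def sum.distrib add_divide_distrib sum_divide_distrib mult.commute)
  \<comment> \<open>With \<open>g a\<close> fixed to \<open>e0\<close>, collisions with
    \<open>a\<close> become a cost of the single values \<open>g y\<close>. Generalising over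
    \<open>u\<close> lets the induction absorb this cost; the applications start from
    \<open>u = 0\<close>.\<close>
  define u' where "u' y e = u y e + w y * of_bool (e = e0)" for y e
  obtain g where g: "\<forall>y\<in>A. g y \<in> L y"
    and gle: "(\<Sum>y\<in>A. u' y (g y)) + (\<Sum>y\<in>A. \<Sum>y'\<in>A - {y}. \<kappa> y y' * of_bool (g y = g y'))
    \<le> (\<Sum>y\<in>A. (\<Sum>e\<in>L y. u' y e) / card (L y))
      + (\<Sum>y\<in>A. \<Sum>y'\<in>A - {y}. \<kappa> y y' * (card (L y \<inter> L y') / (card (L y) * card (L y'))))"
    using insert.IH[of u'] insert.prems by blast
  have u'avg: "(\<Sum>e\<in>L y. u' y e) / card (L y)
      = (\<Sum>e\<in>L y. u y e) / card (L y) + w y * of_bool (e0 \<in> L y) / card (L y)" if "y \<in> A" for y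
  proof -
    have "finite (L y)" using insert.prems that by blast
    then have "(\<Sum>e\<in>L y. of_bool (e = e0) :: real) = of_bool (e0 \<in> L y)"
      by (simp add: of_bool_def sum.delta)
    then show ?thesis
      by (simp add: u'_def sum.distrib add_divide_distrib flip: sum_distrib_left)
  qed
  define g' where "g' = g(a := e0)"
  have g'A: "g' y = g y" if "y \<in> A" for y
    using that insert.hyps by (auto simp: g'_def)
  have g'a: "g' a = e0" by (simp add: g'_def)
  have "(\<Sum>y\<in>insert a A. u y (g' y))
      + (\<Sum>y\<in>insert a A. \<Sum>y'\<in>insert a A - {y}. \<kappa> y y' * of_bool (g' y = g' y'))
    = u a e0 + (\<Sum>y\<in>A. u y (g y)) + ((\<Sum>y\<in>A. \<Sum>y'\<in>A - {y}. \<kappa> y y' * of_bool (g y = g y'))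
      + (\<Sum>y\<in>A. w y * of_bool (g y = e0)))"
    unfolding sum_off_diagonal_insert[OF insert.hyps]
    using insert.hyps g'a by (simp add: g'A w_def algebra_simps eq_commute)
  also have "\<dots> = u a e0 + ((\<Sum>y\<in>A. u' y (g y)) + (\<Sum>y\<in>A. \<Sum>y'\<in>A - {y}. \<kappa> y y' * of_bool (g y = g y')))"
    by (simp add: u'_def sum.distrib)
  also have "\<dots> \<le> u a e0 + ((\<Sum>y\<in>A. (\<Sum>e\<in>L y. u' y e) / card (L y))
      + (\<Sum>y\<in>A. \<Sum>y'\<in>A - {y}. \<kappa> y y' * (card (L y \<inter> L y') / (card (L y) * card (L y')))))"
    using gle by simp
  also have "\<dots> = h e0 + (\<Sum>y\<in>A. (\<Sum>e\<in>L y. u y e) / card (L y))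
      + (\<Sum>y\<in>A. \<Sum>y'\<in>A - {y}. \<kappa> y y' * (card (L y \<inter> L y') / (card (L y) * card (L y'))))"
    by (simp add: u'avg h_def sum.distrib)
  also have "\<dots> \<le> (\<Sum>e\<in>L a. u a e) / card (L a) + (\<Sum>y\<in>A. w y * (card (L a \<inter> L y) / (card (L a) * card (L y))))
      + (\<Sum>y\<in>A. (\<Sum>e\<in>L y. u y e) / card (L y))
      + (\<Sum>y\<in>A. \<Sum>y'\<in>A - {y}. \<kappa> y y' * (card (L y \<inter> L y') / (card (L y) * card (L y'))))"
    using e0 havg by simp
  also have "\<dots> = (\<Sum>y\<in>insert a A. (\<Sum>e\<in>L y. u y e) / card (L y))
      + (\<Sum>y\<in>insert a A. \<Sum>y'\<in>insert a A - {y}. \<kappa> y y' * (card (L y \<inter> L y') / (card (L y) * card (L y'))))"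
    unfolding sum_off_diagonal_insert[OF insert.hyps]
    using insert.hyps by (simp add: w_def algebra_simps add_divide_distrib Int_commute)
  finally show ?case
    using g e0 g'A g'a by (intro exI[of _ g']) auto
qed

text \<open>Maximise the number of edges minus \<open>l1\<close> for each left vertex and
  \<open>l2\<close> for each right vertex; deleting a vertex below its threshold would raise this
  value. Very different thresholds on the two sides are used when one side is much smaller.\<close>

lemma bipartite_min_degree_core:
  fixes R :: "('a \<times> 'b) set" and l1 l2 :: real
  assumes fin: "finite X" "finite Y" and R: "R \<subseteq> X \<times> Y" and nonneg: "0 \<le> l1" "0 \<le> l2"
    and dense: "l1 * card X + l2 * card Y < card R"
  shows "\<exists>X' Y'. X' \<subseteq> X \<and> Y' \<subseteq> Y \<and> X' \<noteq> {} \<and> Y' \<noteq> {} \<and>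
    (\<forall>x\<in>X'. l1 \<le> card (R `` {x} \<inter> Y')) \<and> (\<forall>y\<in>Y'. l2 \<le> card (R\<inverse> `` {y} \<inter> X'))"
proof -
  define F where "F P = real (card (R \<inter> fst P \<times> snd P)) - l1 * card (fst P) - l2 * card (snd P)" for P
  have finR: "finite R" using fin R by (auto intro: finite_subset)
  have finP: "finite (Pow X \<times> Pow Y)" using fin by simp
  then have "Max (F ` (Pow X \<times> Pow Y)) \<in> F ` (Pow X \<times> Pow Y)"
    by (intro Max_in) auto
  then obtain X' Y' where XY: "X' \<subseteq> X" "Y' \<subseteq> Y" and mx: "F (X', Y') = Max (F ` (Pow X \<times> Pow Y))"
    by auto
  have opt: "F (A, B) \<le> F (X', Y')" if "A \<subseteq> X" "B \<subseteq> Y" for A B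
    unfolding mx using that finP by (intro Max_ge) auto
  \<comment> \<open>A positive maximum forces at least one edge, which keeps both sides
    nonempty.\<close>
  have "0 < F (X, Y)"
    using R dense by (simp add: F_def Int_absorb2)
  also have "\<dots> \<le> F (X', Y')" by (rule opt) auto
  finally have "0 < real (card (R \<inter> X' \<times> Y'))"
    using mult_nonneg_nonneg[OF nonneg(1), of "real (card X')"]
      mult_nonneg_nonneg[OF nonneg(2), of "real (card Y')"] by (simp add: F_def)
  then have ne: "X' \<noteq> {}" "Y' \<noteq> {}" by auto
  have fin': "finite X'" "finite Y'" using XY fin by (auto intro: finite_subset)
  have "l1 \<le> card (R `` {x} \<inter> Y')" if x: "x \<in> X'" for x
  proof -
    have "R \<inter> X' \<times> Y' = (R \<inter> (X' - {x}) \<times> Y') \<union> Pair x ` (R `` {x} \<inter> Y')"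
      using x by auto
    moreover have "card ((R \<inter> (X' - {x}) \<times> Y') \<union> Pair x ` (R `` {x} \<inter> Y'))
        = card (R \<inter> (X' - {x}) \<times> Y') + card (Pair x ` (R `` {x} \<inter> Y'))"
      using finR fin' by (intro card_Un_disjoint) auto
    moreover have "card (Pair x ` (R `` {x} \<inter> Y')) = card (R `` {x} \<inter> Y')"
      by (intro card_image) (auto simp: inj_on_def)
    moreover have "F (X' - {x}, Y') \<le> F (X', Y')"
      using XY by (intro opt) auto
    moreover have "real (card (X' - {x})) = real (card X') - 1"
      using x fin' ne by (simp add: of_nat_diff card_gt_0_iff Suc_le_eq)
    ultimately show ?thesis by (simp add: F_def algebra_simps)
  qed
  moreover have "l2 \<le> card (R\<inverse> `` {y} \<inter> X')" if y: "y \<in> Y'" for y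
  proof -
    have "R \<inter> X' \<times> Y' = (R \<inter> X' \<times> (Y' - {y})) \<union> (\<lambda>x. (x, y)) ` (R\<inverse> `` {y} \<inter> X')"
      using y by auto
    moreover have "card ((R \<inter> X' \<times> (Y' - {y})) \<union> (\<lambda>x. (x, y)) ` (R\<inverse> `` {y} \<inter> X'))
        = card (R \<inter> X' \<times> (Y' - {y})) + card ((\<lambda>x. (x, y)) ` (R\<inverse> `` {y} \<inter> X'))"
      using finR fin' by (intro card_Un_disjoint) auto
    moreover have "card ((\<lambda>x. (x, y)) ` (R\<inverse> `` {y} \<inter> X')) = card (R\<inverse> `` {y} \<inter> X')"
      by (intro card_image) (auto simp: inj_on_def)
    moreover have "F (X', Y' - {y}) \<le> F (X', Y')"
      using XY by (intro opt) auto
    moreover have "real (card (Y' - {y})) = real (card Y') - 1"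
      using y fin' ne by (simp add: of_nat_diff card_gt_0_iff Suc_le_eq)
    ultimately show ?thesis by (simp add: F_def algebra_simps)
  qed
  ultimately show ?thesis using XY ne by blast
qed

text \<open>One greedy pass over \<open>Y\<close> suffices: a vertex rejected at its turn stays
  rejected, because the leaves available to it only decrease.\<close>

lemma star_packing:
  fixes N :: "'b \<Rightarrow> 'a set"
  assumes "finite Y"
  shows "\<exists>Z S. Z \<subseteq> Y \<and> (\<forall>z\<in>Z. S z \<subseteq> N z \<and> card (S z) = a) \<and>
    disjoint_family_on S Z \<and> (\<forall>y\<in>Y - Z. finite (N y) \<longrightarrow> card (N y - \<Union> (S ` Z)) < a)"
  using assms
proof (induction Y rule: finite_induct)
  case empty
  then show ?case by (auto simp: disjoint_family_on_def)
next
  case (insert y Y)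
  then obtain Z S where Z: "Z \<subseteq> Y" "\<forall>z\<in>Z. S z \<subseteq> N z \<and> card (S z) = a" "disjoint_family_on S Z"
    "\<forall>y\<in>Y - Z. finite (N y) \<longrightarrow> card (N y - \<Union> (S ` Z)) < a"
    by blast
  show ?case
  proof (cases "finite (N y) \<longrightarrow> card (N y - \<Union> (S ` Z)) < a")
    case True
    then show ?thesis using Z by (intro exI[of _ Z] exI[of _ S]) auto
  next
    case False
    then obtain T where T: "T \<subseteq> N y - \<Union> (S ` Z)" "card T = a"
      by (meson not_less obtain_subset_with_card_n)
    have yZ: "y \<notin> Z" using Z insert by auto
    define S' where "S' = S(y := T)"
    have S'y: "S' y = T" and S'Z: "\<And>z. z \<in> Z \<Longrightarrow> S' z = S z"
      using yZ by (auto simp: S'_def)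
    have U: "\<Union> (S' ` insert y Z) = T \<union> \<Union> (S ` Z)"
      using S'y S'Z by auto
    have "card (N z - \<Union> (S' ` insert y Z)) < a" if "z \<in> Y - Z" "finite (N z)" for z
    proof -
      have "card (N z - \<Union> (S' ` insert y Z)) \<le> card (N z - \<Union> (S ` Z))"
        unfolding U using that by (intro card_mono) auto
      then show ?thesis using Z(4) that by fastforce
    qed
    moreover have "disjoint_family_on S' (insert y Z)"
      using Z(3) T(1) yZ by (auto simp: disjoint_family_on_def S'y S'Z)
    moreover have "\<forall>z\<in>insert y Z. S' z \<subseteq> N z \<and> card (S' z) = a"
      using Z(2) T by (auto simp: S'y S'Z)
    ultimately show ?thesis
      using Z(1) by (intro exI[of _ "insert y Z"] exI[of _ S']) blast
  qed
qed

subsection \<open>Double counting of common neighbours\<close>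

text \<open>The double counting of Kovari, Sos and Turan: pairs of a vertex \<open>y\<close> and an
  \<open>s\<close>-subset of \<open>M y \<inter> S\<close> are counted first by \<open>y\<close>,
  then by the subset.\<close>

lemma subset_double_count:
  fixes M :: "'b \<Rightarrow> 'a set"
  assumes fin: "finite S" "finite T"
    and free: "\<And>A. A \<subseteq> S \<Longrightarrow> card A = s \<Longrightarrow> card {y \<in> T. A \<subseteq> M y} \<le> k"
  shows "(\<Sum>y\<in>T. card (M y \<inter> S) choose s) \<le> k * (card S choose s)"
proof -
  define P where "P = {A. A \<subseteq> S \<and> card A = s}"
  have finP: "finite P" using fin by (simp add: P_def)
  have "card (M y \<inter> S) choose s = (\<Sum>A\<in>P. of_bool (A \<subseteq> M y))" for y
  proof -
    have "card (M y \<inter> S) choose s = card {A. A \<subseteq> M y \<inter> S \<and> card A = s}"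
      using fin by (intro n_subsets[symmetric]) auto
    also have "{A. A \<subseteq> M y \<inter> S \<and> card A = s} = P \<inter> {A. A \<subseteq> M y}"
      by (auto simp: P_def)
    finally show ?thesis using finP by simp
  qed
  then have "(\<Sum>y\<in>T. card (M y \<inter> S) choose s) = (\<Sum>A\<in>P. \<Sum>y\<in>T. of_bool (A \<subseteq> M y))"
    by (simp add: sum.swap[of _ P])
  also have "\<dots> \<le> (\<Sum>A\<in>P. k)"
  proof (rule sum_mono)
    fix A assume "A \<in> P"
    moreover have "T \<inter> {y. A \<subseteq> M y} = {y \<in> T. A \<subseteq> M y}" by auto
    ultimately show "(\<Sum>y\<in>T. of_bool (A \<subseteq> M y)) \<le> k"
      using free fin by (simp add: P_def)
  qed
  also have "\<dots> = k * (card S choose s)"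
    using n_subsets[OF fin(1), of s] by (simp add: P_def)
  finally show ?thesis .
qed

text \<open>For n \<ge> s the binomial coefficient is at least (n / s)^s, so the binomial count
  becomes a bound on a power sum. Smaller intersections are left out because their binomial
  coefficient vanishes.\<close>

lemma power_sum_le_of_common_nbrs:
  fixes M :: "'b \<Rightarrow> 'a set"
  assumes fin: "finite S" "finite T"
    and free: "\<And>A. A \<subseteq> S \<Longrightarrow> card A = s \<Longrightarrow> card {y \<in> T. A \<subseteq> M y} \<le> k"
  shows "(\<Sum>y\<in>{y \<in> T. s \<le> card (M y \<inter> S)}. real (card (M y \<inter> S)) ^ s)
    \<le> real s ^ s * k * real (card S) ^ s"
proof -
  have "real (card (M y \<inter> S)) ^ s \<le> real s ^ s * (card (M y \<inter> S) choose s)"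
    if "s \<le> card (M y \<inter> S)" for y
  proof (cases "s = 0")
    case False
    then show ?thesis
      using binomial_ge_n_over_k_pow_k[OF that, where 'a=real]
      by (simp add: power_divide field_simps)
  qed simp
  then have "(\<Sum>y\<in>{y \<in> T. s \<le> card (M y \<inter> S)}. real (card (M y \<inter> S)) ^ s)
      \<le> (\<Sum>y\<in>{y \<in> T. s \<le> card (M y \<inter> S)}. real s ^ s * (card (M y \<inter> S) choose s))"
    by (intro sum_mono) auto
  also have "\<dots> \<le> (\<Sum>y\<in>T. real s ^ s * (card (M y \<inter> S) choose s))"
    using fin by (intro sum_mono2) auto
  also have "\<dots> = real s ^ s * real (\<Sum>y\<in>T. card (M y \<inter> S) choose s)"
    by (simp add: sum_distrib_left)
  also have "\<dots> \<le> real s ^ s * real (k * (card S choose s))"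
    using subset_double_count[OF fin free] by (intro mult_left_mono of_nat_mono) auto
  also have "\<dots> \<le> real s ^ s * (k * real (card S) ^ s)"
  proof -
    have "real (card S choose s) \<le> real (card S) ^ s"
    proof (cases "s \<le> card S")
      case True
      then show ?thesis using binomial_le_pow[of s "card S"] by (simp flip: of_nat_power)
    qed (simp add: binomial_eq_0)
    then show ?thesis by (auto intro!: mult_left_mono)
  qed
  finally show ?thesis by simp
qed

text \<open>A vertex meeting \<open>S\<close> in fewer than \<open>s\<close> points contributes at
  most \<open>s\<close>; any other contributes at most its \<open>s\<close>-th power, and these
  powers are bounded in total. So edges leaving a small \<open>S\<close> cannot concentrate on few
  vertices.\<close>

lemma sum_card_le_distinct:
  fixes M :: "'b \<Rightarrow> 'a set"
  assumes fin: "finite S" "finite T" and s: "1 \<le> s"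
    and free: "\<And>A. A \<subseteq> S \<Longrightarrow> card A = s \<Longrightarrow> card {y \<in> T. A \<subseteq> M y} \<le> k"
  shows "real (\<Sum>y\<in>T. card (M y \<inter> S)) \<le> s * real (card {y \<in> T. M y \<inter> S \<noteq> {}})
    + real s ^ s * k * real (card S) ^ s"
proof -
  let ?m = "\<lambda>y. real (card (M y \<inter> S))"
  have "?m y \<le> real s * of_bool (M y \<inter> S \<noteq> {}) + of_bool (s \<le> card (M y \<inter> S)) * ?m y ^ s" for y
  proof (cases "M y \<inter> S = {} \<or> card (M y \<inter> S) < s")
    case False
    then have "1 \<le> ?m y" using s by simp
    then have "?m y \<le> ?m y ^ s" using s by (intro self_le_power) auto
    then have "?m y \<le> s + ?m y ^ s" by (rule add_increasing[rotated]) simp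
    then show ?thesis using False by auto
  qed auto
  then have "(\<Sum>y\<in>T. ?m y)
      \<le> (\<Sum>y\<in>T. real s * of_bool (M y \<inter> S \<noteq> {}) + of_bool (s \<le> card (M y \<inter> S)) * ?m y ^ s)"
    by (rule sum_mono)
  also have "\<dots> = real s * (\<Sum>y\<in>T. of_bool (M y \<inter> S \<noteq> {})) + (\<Sum>y\<in>T. of_bool (s \<le> card (M y \<inter> S)) * ?m y ^ s)"
    by (simp add: sum.distrib sum_distrib_left)
  finally have "(\<Sum>y\<in>T. ?m y) \<le> real s * (\<Sum>y\<in>T. of_bool (M y \<inter> S \<noteq> {}))
      + (\<Sum>y\<in>T. of_bool (s \<le> card (M y \<inter> S)) * ?m y ^ s)" .
  moreover have "(\<Sum>y\<in>T. of_bool (M y \<inter> S \<noteq> {})) = real (card {y \<in> T. M y \<inter> S \<noteq> {}})"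
    using fin by (simp add: Collect_conj_eq)
  moreover have "(\<Sum>y\<in>T. of_bool (s \<le> card (M y \<inter> S)) * ?m y ^ s)
      = (\<Sum>y\<in>{y \<in> T. s \<le> card (M y \<inter> S)}. ?m y ^ s)"
    using fin by (intro sum.mono_neutral_cong_right) auto
  moreover have "\<dots> \<le> real s ^ s * k * real (card S) ^ s"
    using power_sum_le_of_common_nbrs[OF fin free] by simp
  ultimately show ?thesis by simp
qed

text \<open>When elements are added one at a time, a new one fails to enlarge the image only if it
  collides with an earlier one. Counting ordered pairs only weakens the bound.\<close>

lemma card_image_ge_collisions:
  fixes g :: "'a \<Rightarrow> 'b"
  assumes "finite B"
  shows "real (card B) - (\<Sum>y\<in>B. \<Sum>y'\<in>B - {y}. of_bool (g y = g y')) \<le> card (g ` B)"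
  using assms
proof (induction B rule: finite_induct)
  case (insert a A)
  have "(\<Sum>y\<in>A. of_bool (g y = g a) + of_bool (g a = g y) :: real) \<ge> of_bool (g a \<in> g ` A)"
  proof (cases "g a \<in> g ` A")
    case True
    then obtain y where y: "y \<in> A" "g y = g a" by auto
    have "(1::real) \<le> of_bool (g y = g a) + of_bool (g a = g y)" using y by simp
    also have "\<dots> \<le> (\<Sum>y\<in>A. of_bool (g y = g a) + of_bool (g a = g y))"
      using y insert by (intro member_le_sum) auto
    finally show ?thesis using True by simp
  qed (simp add: sum_nonneg)
  moreover have "real (card (g ` insert a A)) = real (card (g ` A)) + 1 - of_bool (g a \<in> g ` A)"
    using insert by (simp add: card_insert_if)
  moreover have "real (card (insert a A)) = real (card A) + 1"
    using insert by simp
  ultimately show ?case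
    unfolding sum_off_diagonal_insert[OF insert.hyps]
    using insert.IH by linarith
qed simp

text \<open>The weight is at most the sum of \<open>n e ^ 2\<close>. Where \<open>n e\<close> is at
  most 1 / (128 q), one factor is replaced by that bound and the \<open>n e\<close> sum to |T|.
  Elsewhere \<open>e\<close> has at least \<open>s\<close> neighbours in \<open>T\<close>, and the
  common-neighbour count applies. Each part gives at most |T| / (128 q).\<close>

lemma collision_weight_le:
  fixes N :: "'b \<Rightarrow> 'a set" and q d s k :: nat
  assumes fin: "finite X" "finite T" and N: "\<And>y. y \<in> T \<Longrightarrow> N y \<subseteq> X \<and> d \<le> card (N y)"
    and s: "2 \<le> s" and q: "0 < q" and d: "128 * q * s \<le> d"
    and free: "\<And>A. A \<subseteq> T \<Longrightarrow> card A = s \<Longrightarrow> card {e \<in> X. \<forall>y\<in>A. e \<in> N y} \<le> k"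
    and small: "(128 * real q) ^ (s - 1) * real s ^ s * k * real (card T) ^ (s - 1) \<le> real d ^ s"
  shows "16 * real q * (\<Sum>y\<in>T. \<Sum>y'\<in>T - {y}. card (N y \<inter> N y') / (real (card (N y)) * card (N y')))
    \<le> card T / 4"
proof -
  let ?D = "\<lambda>y. real (card (N y))"
  \<comment> \<open>If every \<open>y\<close> in \<open>T\<close> chooses uniformly from
    \<open>N y\<close>, then \<open>n e\<close> is the expected number of vertices choosing
    \<open>e\<close>.\<close>
  define n where "n e = (\<Sum>y\<in>T. of_bool (e \<in> N y) / ?D y)" for e
  define M where "M e = {y. e \<in> N y}" for e
  have d0: "0 < d" using d q s by (cases d) auto
  have D: "real d \<le> ?D y" "0 < ?D y" if "y \<in> T" for y
    using N[OF that] d0 by auto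
  have n0: "0 \<le> n e" for e by (auto simp: n_def intro!: sum_nonneg)
  \<comment> \<open>The diagonal is added so that, summed over \<open>e\<close>, the double sum
    becomes a perfect square.\<close>
  have "(\<Sum>y\<in>T. \<Sum>y'\<in>T - {y}. card (N y \<inter> N y') / (?D y * ?D y'))
      \<le> (\<Sum>y\<in>T. \<Sum>y'\<in>T. card (N y \<inter> N y') / (?D y * ?D y'))"
    using fin by (intro sum_mono sum_mono2) auto
  also have "\<dots> = (\<Sum>y\<in>T. \<Sum>y'\<in>T. \<Sum>e\<in>X. of_bool (e \<in> N y) / ?D y * (of_bool (e \<in> N y') / ?D y'))"
  proof (intro sum.cong refl)
    fix y y' assume y: "y \<in> T" "y' \<in> T"
    have "X \<inter> (N y \<inter> N y') = N y \<inter> N y'" using N y by auto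
    then have "real (card (N y \<inter> N y')) = (\<Sum>e\<in>X. of_bool (e \<in> N y) * of_bool (e \<in> N y'))"
      using fin by (simp flip: of_bool_conj) (metis Int_def)
    then show "card (N y \<inter> N y') / (?D y * ?D y')
        = (\<Sum>e\<in>X. of_bool (e \<in> N y) / ?D y * (of_bool (e \<in> N y') / ?D y'))"
      by (simp add: sum_divide_distrib)
  qed
  also have "\<dots> = (\<Sum>y\<in>T. \<Sum>e\<in>X. \<Sum>y'\<in>T. of_bool (e \<in> N y) / ?D y * (of_bool (e \<in> N y') / ?D y'))"
    by (rule sum.cong[OF refl], rule sum.swap)
  also have "\<dots> = (\<Sum>e\<in>X. n e * n e)"
    unfolding n_def sum_product by (rule sum.swap)
  finally have "(\<Sum>y\<in>T. \<Sum>y'\<in>T - {y}. card (N y \<inter> N y') / (?D y * ?D y')) \<le> (\<Sum>e\<in>X. n e * n e)" .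
  also have "\<dots> \<le> (\<Sum>e\<in>X. n e / (128 * real q) + of_bool (s \<le> card (M e \<inter> T)) *
      ((128 * real q) ^ (s - 2) / real d ^ s * real (card (M e \<inter> T)) ^ s))"
  proof (rule sum_mono)
    fix e
    show "n e * n e \<le> n e / (128 * real q) + of_bool (s \<le> card (M e \<inter> T)) *
        ((128 * real q) ^ (s - 2) / real d ^ s * real (card (M e \<inter> T)) ^ s)"
    proof (cases "128 * real q * n e \<le> 1")
      case True
      then have "n e \<le> 1 / (128 * real q)" using q by (simp add: field_simps)
      then have "n e * n e \<le> n e * (1 / (128 * real q))" using n0 by (intro mult_left_mono)
      then show ?thesis by (simp add: add_increasing2)
    next
      case False
      have "n e \<le> (\<Sum>y\<in>T. of_bool (e \<in> N y) / d)"
        unfolding n_def using D d0 by (intro sum_mono divide_left_mono mult_pos_pos) auto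
      also have "\<dots> = card (M e \<inter> T) / d"
        using fin by (simp add: M_def Int_commute flip: sum_divide_distrib)
      finally have ne: "n e \<le> card (M e \<inter> T) / d" .
      \<comment> \<open>A large \<open>n e\<close> together with d \<ge> 128 q s yields at least
        \<open>s\<close> neighbours of \<open>e\<close> in \<open>T\<close>, the range in which the
        power sum bound is available.\<close>
      have "real s * (128 * real q) \<le> d" using of_nat_mono[OF d, where 'a=real] by (simp add: mult_ac)
      then have "real s \<le> d * (1 / (128 * real q))" using q by (simp add: field_simps)
      also have "\<dots> \<le> d * n e" using False q by (intro mult_left_mono) (auto simp: field_simps)
      also have "\<dots> \<le> card (M e \<inter> T)" using ne d0 by (simp add: field_simps)
      finally have sM: "s \<le> card (M e \<inter> T)" by simp
      \<comment> \<open>Multiplying by \<open>s - 2\<close> further factors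
        \<open>128 * q * n e\<close>, each at least 1, raises the square to the \<open>s\<close>-th
        power that the double counting controls.\<close>
      have "n e * n e = n e ^ 2 * 1" by (simp add: power2_eq_square)
      also have "\<dots> \<le> n e ^ 2 * (128 * real q * n e) ^ (s - 2)"
        using False n0 by (intro mult_left_mono one_le_power) auto
      also have "\<dots> = (128 * real q) ^ (s - 2) * n e ^ (2 + (s - 2))"
        by (simp add: power_mult_distrib power_add power2_eq_square mult_ac)
      also have "2 + (s - 2) = s" using s by simp
      also have "(128 * real q) ^ (s - 2) * n e ^ s \<le> (128 * real q) ^ (s - 2) * (card (M e \<inter> T) / d) ^ s"
        using ne n0 by (intro mult_left_mono power_mono) auto
      finally show ?thesis
        using sM n0 by (simp add: power_divide add_increasing)
    qed
  qed
  also have "\<dots> = (\<Sum>e\<in>X. n e) / (128 * real q) + (128 * real q) ^ (s - 2) / real d ^ s *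
      (\<Sum>e\<in>{e \<in> X. s \<le> card (M e \<inter> T)}. real (card (M e \<inter> T)) ^ s)"
  proof -
    have "(\<Sum>e\<in>X. of_bool (s \<le> card (M e \<inter> T)) *
        ((128 * real q) ^ (s - 2) / real d ^ s * real (card (M e \<inter> T)) ^ s))
      = (\<Sum>e\<in>{e \<in> X. s \<le> card (M e \<inter> T)}. (128 * real q) ^ (s - 2) / real d ^ s * real (card (M e \<inter> T)) ^ s)"
      using fin by (intro sum.mono_neutral_cong_right) auto
    then show ?thesis
      by (simp add: sum.distrib sum_divide_distrib sum_distrib_left)
  qed
  also have "(\<Sum>e\<in>X. n e) = card T"
  proof -
    have "(\<Sum>e\<in>X. n e) = (\<Sum>y\<in>T. \<Sum>e\<in>X. of_bool (e \<in> N y) / ?D y)"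
      unfolding n_def by (rule sum.swap)
    also have "\<dots> = (\<Sum>y\<in>T. 1)"
    proof (intro sum.cong refl)
      fix y assume y: "y \<in> T"
      have "X \<inter> N y = N y" using N y by auto
      then show "(\<Sum>e\<in>X. of_bool (e \<in> N y) / ?D y) = 1"
        using D[OF y] fin by (simp flip: sum_divide_distrib)
    qed
    finally show ?thesis by simp
  qed
  also have "(\<Sum>e\<in>{e \<in> X. s \<le> card (M e \<inter> T)}. real (card (M e \<inter> T)) ^ s)
      \<le> real s ^ s * k * real (card T) ^ s"
  proof (rule power_sum_le_of_common_nbrs[OF fin(2,1)])
    fix A assume "A \<subseteq> T" "card A = s"
    moreover have "{e \<in> X. A \<subseteq> M e} = {e \<in> X. \<forall>y\<in>A. e \<in> N y}" by (auto simp: M_def)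
    ultimately show "card {e \<in> X. A \<subseteq> M e} \<le> k" using free by simp
  qed
  finally have K: "(\<Sum>y\<in>T. \<Sum>y'\<in>T - {y}. card (N y \<inter> N y') / (?D y * ?D y'))
      \<le> card T / (128 * real q) + (128 * real q) ^ (s - 2) / real d ^ s * (real s ^ s * k * real (card T) ^ s)"
    by (simp add: mult_left_mono divide_right_mono)
  have "128 * real q * ((128 * real q) ^ (s - 2) / real d ^ s * (real s ^ s * k * real (card T) ^ s))
      = ((128 * real q) ^ (s - 1) * real s ^ s * k * real (card T) ^ (s - 1)) / real d ^ s * card T"
  proof -
    obtain r where r: "s = Suc (Suc r)" using s by (metis add_2_eq_Suc le_Suc_ex)
    show ?thesis by (simp add: r)
  qed
  also have "\<dots> \<le> 1 * real (card T)"
    using small d0 by (intro mult_right_mono) auto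
  finally have "128 * real q * (card T / (128 * real q) +
      (128 * real q) ^ (s - 2) / real d ^ s * (real s ^ s * k * real (card T) ^ s)) \<le> 2 * real (card T)"
    using q by (simp add: distrib_left)
  moreover have "128 * real q * (\<Sum>y\<in>T. \<Sum>y'\<in>T - {y}. card (N y \<inter> N y') / (?D y * ?D y'))
    \<le> 128 * real q * (card T / (128 * real q) +
      (128 * real q) ^ (s - 2) / real d ^ s * (real s ^ s * k * real (card T) ^ s))"
    using K by (intro mult_left_mono) auto
  ultimately show ?thesis by simp
qed

subsection \<open>Random grouping, derandomised\<close>

lemma sum_sum_off_diagonal_subset:
  fixes h :: "'a \<Rightarrow> 'a \<Rightarrow> real"
  assumes "finite X" "B \<subseteq> X"
  shows "(\<Sum>x\<in>X. \<Sum>x'\<in>X - {x}. of_bool (x \<in> B \<and> x' \<in> B) * h x x')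
    = (\<Sum>x\<in>B. \<Sum>x'\<in>B. h x x') - (\<Sum>x\<in>B. h x x)"
proof -
  have finB: "finite B" using assms by (auto intro: finite_subset)
  have "(\<Sum>x\<in>X. \<Sum>x'\<in>X - {x}. of_bool (x \<in> B \<and> x' \<in> B) * h x x')
      = (\<Sum>x\<in>B. \<Sum>x'\<in>X - {x}. of_bool (x \<in> B \<and> x' \<in> B) * h x x')"
    using assms by (intro sum.mono_neutral_right) auto
  also have "\<dots> = (\<Sum>x\<in>B. (\<Sum>x'\<in>B. h x x') - h x x)"
  proof (rule sum.cong[OF refl])
    fix x assume x: "x \<in> B"
    have "(\<Sum>x'\<in>X - {x}. of_bool (x \<in> B \<and> x' \<in> B) * h x x') = (\<Sum>x'\<in>B - {x}. h x x')"
      using assms x by (intro sum.mono_neutral_cong_right) auto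
    then show "(\<Sum>x'\<in>X - {x}. of_bool (x \<in> B \<and> x' \<in> B) * h x x') = (\<Sum>x'\<in>B. h x x') - h x x"
      using x finB by (simp add: sum_diff1)
  qed
  finally show ?thesis by (simp add: sum_subtractf)
qed

lemma sum_sum_same_colour:
  fixes \<phi> :: "'a \<Rightarrow> nat"
  assumes "finite B" "\<And>x. x \<in> B \<Longrightarrow> \<phi> x < q"
  shows "(\<Sum>x\<in>B. \<Sum>x'\<in>B. of_bool (\<phi> x = \<phi> x') :: real) = (\<Sum>j<q. (real (card {x \<in> B. \<phi> x = j}))\<^sup>2)"
proof -
  have "(\<Sum>x\<in>B. \<Sum>x'\<in>B. of_bool (\<phi> x = \<phi> x') :: real)
      = (\<Sum>x\<in>B. \<Sum>x'\<in>B. \<Sum>j<q. of_bool (\<phi> x = j) * of_bool (\<phi> x' = j))"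
  proof (intro sum.cong refl)
    fix x x' assume "x \<in> B" "x' \<in> B"
    have "(\<Sum>j<q. of_bool (\<phi> x = j) * of_bool (\<phi> x' = j) :: real) = (\<Sum>j<q. if j = \<phi> x then of_bool (\<phi> x' = j) else 0)"
      by (intro sum.cong) auto
    also have "\<dots> = of_bool (\<phi> x = \<phi> x')"
      using assms(2)[OF \<open>x \<in> B\<close>] by (simp add: eq_commute)
    finally show "of_bool (\<phi> x = \<phi> x') = (\<Sum>j<q. of_bool (\<phi> x = j) * of_bool (\<phi> x' = j) :: real)" ..
  qed
  also have "\<dots> = (\<Sum>x\<in>B. \<Sum>j<q. \<Sum>x'\<in>B. of_bool (\<phi> x = j) * of_bool (\<phi> x' = j))"
    by (rule sum.cong[OF refl], rule sum.swap)
  also have "\<dots> = (\<Sum>j<q. \<Sum>x\<in>B. \<Sum>x'\<in>B. of_bool (\<phi> x = j) * of_bool (\<phi> x' = j))"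
    by (rule sum.swap)
  also have "\<dots> = (\<Sum>j<q. (\<Sum>x\<in>B. of_bool (\<phi> x = j)) * (\<Sum>x\<in>B. of_bool (\<phi> x = j)))"
    unfolding sum_product ..
  also have "\<dots> = (\<Sum>j<q. (real (card {x \<in> B. \<phi> x = j}))\<^sup>2)"
    using assms(1) by (simp add: power2_eq_square Collect_conj_eq)
  finally show ?thesis .
qed

lemma sum_card_colour_classes:
  assumes "finite B" "\<And>x. x \<in> B \<Longrightarrow> \<phi> x < (q::nat)"
  shows "(\<Sum>j<q. real (card {x \<in> B. \<phi> x = j})) = card B"
proof -
  have "(\<Sum>j<q. real (card {x \<in> B. \<phi> x = j})) = (\<Sum>j<q. \<Sum>x\<in>B. of_bool (\<phi> x = j))"
    using assms(1) by (simp add: Collect_conj_eq)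
  also have "\<dots> = (\<Sum>x\<in>B. \<Sum>j<q. of_bool (\<phi> x = j))"
    by (rule sum.swap)
  also have "\<dots> = (\<Sum>x\<in>B. 1)"
  proof (rule sum.cong[OF refl])
    fix x assume "x \<in> B"
    have "(\<Sum>j<q. of_bool (\<phi> x = j) :: real) = (\<Sum>j<q. if j = \<phi> x then 1 else 0)"
      by (intro sum.cong) auto
    then show "(\<Sum>j<q. of_bool (\<phi> x = j) :: real) = 1"
      using assms(2)[OF \<open>x \<in> B\<close>] by simp
  qed
  finally show ?thesis by simp
qed

text \<open>A derandomised Chebyshev inequality: the colouring has at most the expected number of
  monochromatic pairs inside the sets \<open>N p\<close>, so that the class sizes have small variance.\<close>

lemma balanced_colouring:
  fixes N :: "'p \<Rightarrow> 'a set" and q d :: nat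
  assumes fin: "finite X" "finite P" and N: "\<And>p. p \<in> P \<Longrightarrow> N p \<subseteq> X \<and> d \<le> card (N p)"
    and q: "0 < q" and d: "0 < d"
  shows "\<exists>\<phi>. (\<forall>x\<in>X. \<phi> x < q) \<and>
    (\<Sum>j<q. real (card {p \<in> P. 2 * q * card {x \<in> N p. \<phi> x = j} < card (N p)})) \<le> 4 * q\<^sup>2 * card P / d"
proof -
  let ?D = "\<lambda>p. real (card (N p))"
  \<comment> \<open>Dividing by the square of the size of \<open>N p\<close> gives all sets
    \<open>N p\<close> comparable weight, whatever their sizes.\<close>
  define \<kappa> where "\<kappa> x x' = (\<Sum>p\<in>P. of_bool (x \<in> N p \<and> x' \<in> N p) / (?D p)\<^sup>2)" for x x'
  have D: "real d \<le> ?D p" "0 < ?D p" if "p \<in> P" for p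
    using N[OF that] d by auto
  have finN: "finite (N p)" if "p \<in> P" for p
    using N[OF that] fin by (auto intro: finite_subset)
  \<comment> \<open>Two independent uniform colours among \<open>q\<close> agree with probability 1
    / q.\<close>
  obtain \<phi> where \<phi>: "\<forall>x\<in>X. \<phi> x \<in> {..<q}"
    and le: "(\<Sum>x\<in>X. \<Sum>x'\<in>X - {x}. \<kappa> x x' * of_bool (\<phi> x = \<phi> x'))
      \<le> (\<Sum>x\<in>X. \<Sum>x'\<in>X - {x}. \<kappa> x x' * (1 / q))"
    using averaging_choice[OF fin(1), of "\<lambda>_. {..<q}" "\<lambda>_ _. 0" \<kappa>] q by auto
  define n where "n p j = real (card {x \<in> N p. \<phi> x = j})" for p j
  have swap: "(\<Sum>x\<in>X. \<Sum>x'\<in>X - {x}. \<kappa> x x' * h x x')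
      = (\<Sum>p\<in>P. ((\<Sum>x\<in>N p. \<Sum>x'\<in>N p. h x x') - (\<Sum>x\<in>N p. h x x)) / (?D p)\<^sup>2)" for h
  proof -
    have "(\<Sum>x\<in>X. \<Sum>x'\<in>X - {x}. \<kappa> x x' * h x x')
        = (\<Sum>x\<in>X. \<Sum>x'\<in>X - {x}. \<Sum>p\<in>P. of_bool (x \<in> N p \<and> x' \<in> N p) * h x x' / (?D p)\<^sup>2)"
      by (simp add: \<kappa>_def sum_distrib_right)
    also have "\<dots> = (\<Sum>x\<in>X. \<Sum>p\<in>P. \<Sum>x'\<in>X - {x}. of_bool (x \<in> N p \<and> x' \<in> N p) * h x x' / (?D p)\<^sup>2)"
      by (rule sum.cong[OF refl], rule sum.swap)
    also have "\<dots> = (\<Sum>p\<in>P. \<Sum>x\<in>X. \<Sum>x'\<in>X - {x}. of_bool (x \<in> N p \<and> x' \<in> N p) * h x x' / (?D p)\<^sup>2)"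
      by (rule sum.swap)
    also have "\<dots> = (\<Sum>p\<in>P. (\<Sum>x\<in>X. \<Sum>x'\<in>X - {x}. of_bool (x \<in> N p \<and> x' \<in> N p) * h x x') / (?D p)\<^sup>2)"
      by (simp only: sum_divide_distrib)
    also have "\<dots> = (\<Sum>p\<in>P. ((\<Sum>x\<in>N p. \<Sum>x'\<in>N p. h x x') - (\<Sum>x\<in>N p. h x x)) / (?D p)\<^sup>2)"
      using N by (intro sum.cong refl arg_cong2[where f="(/)"] sum_sum_off_diagonal_subset fin) auto
    finally show ?thesis .
  qed
  have "(\<Sum>p\<in>P. ((\<Sum>j<q. (n p j)\<^sup>2) - ?D p) / (?D p)\<^sup>2) \<le> (\<Sum>p\<in>P. ((?D p)\<^sup>2 / q - ?D p / q) / (?D p)\<^sup>2)"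
  proof -
    have "(\<Sum>x\<in>N p. \<Sum>x'\<in>N p. of_bool (\<phi> x = \<phi> x') :: real) = (\<Sum>j<q. (n p j)\<^sup>2)" if "p \<in> P" for p
      unfolding n_def using N[OF that] \<phi> by (intro sum_sum_same_colour finN that) auto
    then show ?thesis
      using le unfolding swap by (simp add: power2_eq_square)
  qed
  \<comment> \<open>The class sizes sum to the size of \<open>N p\<close>, so their squared
    deviations from the mean are governed by the number of monochromatic pairs.\<close>
  moreover have "(\<Sum>p\<in>P. \<Sum>j<q. (n p j - ?D p / q)\<^sup>2 / (?D p)\<^sup>2)
      = (\<Sum>p\<in>P. ((\<Sum>j<q. (n p j)\<^sup>2) - ?D p) / (?D p)\<^sup>2) - (\<Sum>p\<in>P. ((?D p)\<^sup>2 / q - ?D p) / (?D p)\<^sup>2)"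
  proof -
    have "(\<Sum>j<q. (n p j - ?D p / q)\<^sup>2 / (?D p)\<^sup>2)
        = ((\<Sum>j<q. (n p j)\<^sup>2) - ?D p) / (?D p)\<^sup>2 - ((?D p)\<^sup>2 / q - ?D p) / (?D p)\<^sup>2" if p: "p \<in> P" for p
    proof -
      have sn: "(\<Sum>j<q. n p j) = ?D p"
        unfolding n_def using N[OF p] \<phi> by (intro sum_card_colour_classes finN p) auto
      have "(\<Sum>j<q. (n p j - ?D p / q)\<^sup>2)
          = (\<Sum>j<q. (n p j)\<^sup>2 + (- 2 * ?D p / q) * n p j + (?D p / q)\<^sup>2)"
        by (intro sum.cong refl) (simp add: power2_eq_square algebra_simps)
      also have "\<dots> = (\<Sum>j<q. (n p j)\<^sup>2) + (- 2 * ?D p / q) * (\<Sum>j<q. n p j) + q * (?D p / q)\<^sup>2"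
        by (simp only: sum.distrib sum_distrib_left[symmetric] sum_constant card_lessThan)
      also have "\<dots> = (\<Sum>j<q. (n p j)\<^sup>2) - (?D p)\<^sup>2 / q"
        unfolding sn using q by (simp add: power2_eq_square field_simps)
      finally show ?thesis
        by (simp add: sum_divide_distrib[symmetric] diff_divide_distrib[symmetric])
    qed
    then show ?thesis by (simp add: sum_subtractf)
  qed
  ultimately have "(\<Sum>p\<in>P. \<Sum>j<q. (n p j - ?D p / q)\<^sup>2 / (?D p)\<^sup>2)
      \<le> (\<Sum>p\<in>P. ((?D p)\<^sup>2 / q - ?D p / q) / (?D p)\<^sup>2) - (\<Sum>p\<in>P. ((?D p)\<^sup>2 / q - ?D p) / (?D p)\<^sup>2)"
    by linarith
  also have "\<dots> = (\<Sum>p\<in>P. ((?D p)\<^sup>2 / q - ?D p / q) / (?D p)\<^sup>2 - ((?D p)\<^sup>2 / q - ?D p) / (?D p)\<^sup>2)"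
    by (rule sum_subtractf[symmetric])
  also have "\<dots> \<le> (\<Sum>p\<in>P. 1 / d)"
  proof (rule sum_mono)
    fix p assume p: "p \<in> P"
    \<comment> \<open>Only the diagonal pairs, monochromatic with certainty, remain after the
      cancellation; they contribute at most 1 / d after normalisation.\<close>
    have "((?D p)\<^sup>2 / q - ?D p / q) / (?D p)\<^sup>2 - ((?D p)\<^sup>2 / q - ?D p) / (?D p)\<^sup>2
        = (?D p - ?D p / q) / (?D p)\<^sup>2"
      by (simp add: diff_divide_distrib)
    also have "\<dots> \<le> ?D p / (?D p)\<^sup>2"
      by (intro divide_right_mono) auto
    also have "\<dots> = 1 / ?D p" by (simp add: power2_eq_square)
    also have "\<dots> \<le> 1 / d" using D[OF p] d by (simp add: frac_le)
    finally show "((?D p)\<^sup>2 / q - ?D p / q) / (?D p)\<^sup>2 - ((?D p)\<^sup>2 / q - ?D p) / (?D p)\<^sup>2 \<le> 1 / d" .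
  qed
  finally have var: "(\<Sum>p\<in>P. \<Sum>j<q. (n p j - ?D p / q)\<^sup>2 / (?D p)\<^sup>2) \<le> card P / d" by simp
  have "(\<Sum>j<q. real (card {p \<in> P. 2 * q * card {x \<in> N p. \<phi> x = j} < card (N p)}))
      = (\<Sum>j<q. \<Sum>p\<in>P. of_bool (2 * q * n p j < ?D p))"
  proof (rule sum.cong[OF refl])
    fix j
    have "2 * q * card {x \<in> N p. \<phi> x = j} < card (N p) \<longleftrightarrow> 2 * q * n p j < ?D p" for p
      using of_nat_less_iff[of "2 * q * card {x \<in> N p. \<phi> x = j}" "card (N p)", where 'a=real]
      by (simp add: n_def)
    then have "{p \<in> P. 2 * q * card {x \<in> N p. \<phi> x = j} < card (N p)} = P \<inter> {p. 2 * q * n p j < ?D p}"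
      by auto
    then show "real (card {p \<in> P. 2 * q * card {x \<in> N p. \<phi> x = j} < card (N p)})
        = (\<Sum>p\<in>P. of_bool (2 * q * n p j < ?D p))"
      using fin by simp
  qed
  also have "\<dots> = (\<Sum>p\<in>P. \<Sum>j<q. of_bool (2 * q * n p j < ?D p))"
    by (rule sum.swap)
  also have "\<dots> \<le> (\<Sum>p\<in>P. \<Sum>j<q. 4 * (real q)\<^sup>2 * ((n p j - ?D p / q)\<^sup>2 / (?D p)\<^sup>2))"
  proof (intro sum_mono)
    fix p j assume p: "p \<in> P"
    \<comment> \<open>A class below half of its mean deviates by at least half of the mean, a
      normalised square of 1 / (4 q^2); this explains the factor \<open>4 * q^2\<close>.\<close>
    show "of_bool (2 * q * n p j < ?D p) \<le> 4 * (real q)\<^sup>2 * ((n p j - ?D p / q)\<^sup>2 / (?D p)\<^sup>2)"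
    proof (cases "2 * q * n p j < ?D p")
      case True
      then have "n p j < ?D p / (2 * q)" using q by (simp add: field_simps)
      then have "?D p / (2 * q) \<le> ?D p / q - n p j" using q by (simp add: field_simps)
      then have "(?D p / (2 * q))\<^sup>2 \<le> (?D p / q - n p j)\<^sup>2"
        by (intro power_mono) auto
      also have "\<dots> = (n p j - ?D p / q)\<^sup>2" by (rule power2_commute)
      finally have "4 * (real q)\<^sup>2 * ((?D p / (2 * q))\<^sup>2 / (?D p)\<^sup>2)
          \<le> 4 * (real q)\<^sup>2 * ((n p j - ?D p / q)\<^sup>2 / (?D p)\<^sup>2)"
        by (intro mult_left_mono divide_right_mono) auto
      moreover have "4 * (real q)\<^sup>2 * ((?D p / (2 * q))\<^sup>2 / (?D p)\<^sup>2) = 1"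
        using D[OF p] q by (simp add: power_divide power_mult_distrib)
      ultimately have "1 \<le> 4 * (real q)\<^sup>2 * ((n p j - ?D p / q)\<^sup>2 / (?D p)\<^sup>2)"
        by linarith
      then show ?thesis by (simp only: True of_bool_eq)
    qed simp
  qed
  also have "\<dots> = 4 * (real q)\<^sup>2 * (\<Sum>p\<in>P. \<Sum>j<q. (n p j - ?D p / q)\<^sup>2 / (?D p)\<^sup>2)"
    by (simp only: sum_distrib_left)
  also have "\<dots> \<le> 4 * (real q)\<^sup>2 * (card P / d)"
    using var by (intro mult_left_mono) auto
  finally show ?thesis using \<phi> by (intro exI[of _ \<phi>]) auto
qed

text \<open>After division by the bounds \<open>a1\<close>, ..., \<open>a4\<close> the four
  functions together average at most 4. Where their sum is at most 4, nonnegativity bounds each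
  summand by 4.\<close>

lemma exists_index_below_averages4:
  fixes f1 f2 f3 f4 :: "nat \<Rightarrow> real" and a1 a2 a3 a4 :: real
  assumes q: "0 < q" and pos: "0 < a1" "0 < a2" "0 < a3" "0 < a4"
    and nonneg: "\<And>j. 0 \<le> f1 j" "\<And>j. 0 \<le> f2 j" "\<And>j. 0 \<le> f3 j" "\<And>j. 0 \<le> f4 j"
    and avg: "(\<Sum>j<q. f1 j) \<le> q * a1" "(\<Sum>j<q. f2 j) \<le> q * a2"
      "(\<Sum>j<q. f3 j) \<le> q * a3" "(\<Sum>j<q. f4 j) \<le> q * a4"
  shows "\<exists>j<q. f1 j \<le> 4 * a1 \<and> f2 j \<le> 4 * a2 \<and> f3 j \<le> 4 * a3 \<and> f4 j \<le> 4 * a4"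
proof -
  let ?f = "\<lambda>j. f1 j / a1 + f2 j / a2 + f3 j / a3 + f4 j / a4"
  obtain j where j: "j < q" "?f j \<le> (\<Sum>j<q. ?f j) / q"
    using exists_le_average[of "{..<q}" ?f] q by auto
  have "(\<Sum>j<q. ?f j) \<le> real q + q + q + q"
    unfolding sum.distrib sum_divide_distrib[symmetric]
    using avg pos by (intro add_mono) (auto simp: divide_le_eq)
  then have "(\<Sum>j<q. ?f j) / q \<le> (4 * real q) / q"
    by (intro divide_right_mono) auto
  then have "?f j \<le> 4" using j q by simp
  moreover have "0 \<le> f1 j / a1" "0 \<le> f2 j / a2" "0 \<le> f3 j / a3" "0 \<le> f4 j / a4"
    using nonneg pos by (auto intro!: divide_nonneg_pos)
  ultimately have "f1 j / a1 \<le> 4" "f2 j / a2 \<le> 4" "f3 j / a3 \<le> 4" "f4 j / a4 \<le> 4"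
    by linarith+
  then show ?thesis
    using j(1) pos by (intro exI[of _ j]) (auto simp: divide_le_eq)
qed

text \<open>The weight in assumption \<open>coll\<close> bounds the expected number of collisions under \<open>g\<close>. The colour
  classes of a balanced colouring play the role of a random set of centres of density \<open>1 / q\<close>. The
  vertices \<open>\<xi> i y\<close> are the leaves used to reach \<open>y\<close>; those which become centres are lost.\<close>

lemma grouping:
  fixes N :: "'b \<Rightarrow> 'a set" and T :: "'c \<Rightarrow> 'b set" and \<xi> :: "'c \<Rightarrow> 'b \<Rightarrow> 'a" and q d t :: nat
  assumes fin: "finite X" "finite Y" "finite I"
    and ne: "X \<noteq> {}" "I \<noteq> {}" "0 < t"
    and N: "\<And>y. y \<in> Y \<Longrightarrow> N y \<subseteq> X \<and> d \<le> card (N y)"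
    and T: "\<And>i. i \<in> I \<Longrightarrow> T i \<subseteq> Y \<and> card (T i) = t"
    and \<xi>: "\<And>i y. i \<in> I \<Longrightarrow> y \<in> T i \<Longrightarrow> \<xi> i y \<in> X"
    and q: "40 \<le> q" and d: "160 * q \<le> d"
    and coll: "\<And>i. i \<in> I \<Longrightarrow> 16 * real q *
      (\<Sum>y\<in>T i. \<Sum>y'\<in>T i - {y}. card (N y \<inter> N y') / (real (card (N y)) * card (N y'))) \<le> t / 4"
  shows "\<exists>C g H. C \<subseteq> X \<and> C \<noteq> {} \<and> real q * card C \<le> 4 * card X \<and> H \<subseteq> Y \<and> (\<forall>y\<in>H. g y \<in> N y \<inter> C) \<and>
    real (card I) * t / 4 \<le> (\<Sum>i\<in>I. real (card (g ` {y \<in> T i \<inter> H. \<xi> i y \<notin> C})))"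
proof -
  let ?D = "\<lambda>y. real (card (N y))"
  define P where "P = (SIGMA i:I. T i)"
  define n where "n = real (card I) * t"
  have finT: "finite (T i)" if "i \<in> I" for i
    using T[OF that] fin by (auto intro: finite_subset)
  have finP: "finite P" using fin finT by (simp add: P_def)
  have cardP: "real (card P) = n"
    using fin finT T by (simp add: P_def n_def)
  have n0: "0 < n" using ne fin by (simp add: n_def card_gt_0_iff)
  have q0: "0 < q" and d0: "0 < d" using q d by auto
  have finN: "finite (N y)" if "y \<in> Y" for y
    using N[OF that] fin by (auto intro: finite_subset)
  have D0: "0 < ?D y" if "y \<in> Y" for y using N[OF that] d0 by auto
  obtain \<phi> where \<phi>: "\<And>x. x \<in> X \<Longrightarrow> \<phi> x < q"
    and bad: "(\<Sum>j<q. real (card {p \<in> P. 2 * q * card {x \<in> N (snd p). \<phi> x = j} < card (N (snd p))}))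
      \<le> 4 * q\<^sup>2 * card P / d"
    using balanced_colouring[OF fin(1) finP, of "\<lambda>p. N (snd p)" d q] N T q0 d0
    unfolding P_def by fastforce
  define Cl where "Cl j = {x \<in> X. \<phi> x = j}" for j
  \<comment> \<open>The four quantities to control for one colour class taken as centres: its size,
    the pairs lost because their leaf becomes a centre, the pairs whose \<open>y\<close> has too few
    neighbours in the class, and the collision weight inside the class.\<close>
  define f1 where "f1 j = real (card (Cl j))" for j
  define f2 where "f2 j = real (card {p \<in> P. \<phi> (\<xi> (fst p) (snd p)) = j})" for j
  define f3 where "f3 j = real (card {p \<in> P. 2 * q * card {x \<in> N (snd p). \<phi> x = j} < card (N (snd p))})" for j
  define f4 where "f4 j = (\<Sum>i\<in>I. \<Sum>y\<in>T i. \<Sum>y'\<in>T i - {y}. card (N y \<inter> N y' \<inter> Cl j) / (?D y * ?D y'))" for j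
  have "(\<Sum>j<q. f1 j) \<le> q * (card X / q)"
    unfolding f1_def Cl_def using q0 sum_card_colour_classes[OF fin(1) \<phi>] by simp
  moreover have "(\<Sum>j<q. f2 j) \<le> q * (n / q)"
  proof -
    have "(\<Sum>j<q. f2 j) = card P"
      unfolding f2_def by (rule sum_card_colour_classes[OF finP]) (auto simp: P_def \<phi>[OF \<xi>])
    then show ?thesis using q0 cardP by simp
  qed
  moreover have "(\<Sum>j<q. f3 j) \<le> q * (4 * q * n / d)"
    using bad cardP by (simp add: f3_def power2_eq_square mult_ac)
  moreover have "(\<Sum>j<q. f4 j) \<le> q * (n / (64 * (real q)\<^sup>2))"
  proof -
    have "(\<Sum>j<q. f4 j) = (\<Sum>i\<in>I. \<Sum>j<q. \<Sum>y\<in>T i. \<Sum>y'\<in>T i - {y}. card (N y \<inter> N y' \<inter> Cl j) / (?D y * ?D y'))"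
      unfolding f4_def by (rule sum.swap)
    also have "\<dots> = (\<Sum>i\<in>I. \<Sum>y\<in>T i. \<Sum>j<q. \<Sum>y'\<in>T i - {y}. card (N y \<inter> N y' \<inter> Cl j) / (?D y * ?D y'))"
      by (rule sum.cong[OF refl], rule sum.swap)
    also have "\<dots> = (\<Sum>i\<in>I. \<Sum>y\<in>T i. \<Sum>y'\<in>T i - {y}. \<Sum>j<q. card (N y \<inter> N y' \<inter> Cl j) / (?D y * ?D y'))"
      by (rule sum.cong[OF refl], rule sum.cong[OF refl], rule sum.swap)
    also have "\<dots> = (\<Sum>i\<in>I. \<Sum>y\<in>T i. \<Sum>y'\<in>T i - {y}. card (N y \<inter> N y') / (?D y * ?D y'))"
    proof (intro sum.cong refl)
      fix i y y' assume *: "i \<in> I" "y \<in> T i" "y' \<in> T i - {y}"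
      then have Y: "y \<in> Y" "y' \<in> Y" using T by auto
      have sub: "N y \<inter> N y' \<subseteq> X" using N[OF Y(1)] by auto
      have "N y \<inter> N y' \<inter> Cl j = {x \<in> N y \<inter> N y'. \<phi> x = j}" for j
        using sub by (auto simp: Cl_def)
      then have "(\<Sum>j<q. real (card (N y \<inter> N y' \<inter> Cl j))) = card (N y \<inter> N y')"
        using sum_card_colour_classes[of "N y \<inter> N y'" \<phi> q] finN[OF Y(1)] sub \<phi> by auto
      then show "(\<Sum>j<q. card (N y \<inter> N y' \<inter> Cl j) / (?D y * ?D y')) = card (N y \<inter> N y') / (?D y * ?D y')"
        by (simp flip: sum_divide_distrib)
    qed
    also have "\<dots> \<le> (\<Sum>i\<in>I. t / (64 * real q))"
      using coll q0 by (intro sum_mono) (simp add: field_simps)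
    also have "\<dots> = q * (n / (64 * (real q)\<^sup>2))"
      using q0 by (simp add: n_def power2_eq_square)
    finally show ?thesis .
  qed
  moreover have "0 \<le> f1 j" "0 \<le> f2 j" "0 \<le> f3 j" "0 \<le> f4 j" for j
    by (auto simp: f1_def f2_def f3_def f4_def intro!: sum_nonneg)
  moreover have "0 < card X / q" "0 < n / q" "0 < 4 * q * n / d" "0 < n / (64 * (real q)\<^sup>2)"
    using n0 q0 d0 ne fin by (auto simp: card_gt_0_iff)
  ultimately obtain j where j: "j < q" "f1 j \<le> 4 * (card X / q)" "f2 j \<le> 4 * (n / q)"
      "f3 j \<le> 4 * (4 * q * n / d)" "f4 j \<le> 4 * (n / (64 * (real q)\<^sup>2))"
    using exists_index_below_averages4[OF q0, of "card X / q" "n / q" "4 * q * n / d" "n / (64 * (real q)\<^sup>2)" f1 f2 f3 f4]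
    by blast
  define C where "C = Cl j"
  \<comment> \<open>The vertices with at least half of the expected number of neighbours in
    \<open>C\<close>; they are the ones to be assigned.\<close>
  define H where "H = {y \<in> Y. card (N y) \<le> 2 * q * card (N y \<inter> C)}"
  define B where "B i = {y \<in> T i \<inter> H. \<xi> i y \<notin> C}" for i
  have C: "C \<subseteq> X" by (auto simp: C_def Cl_def)
  have NC: "N y \<inter> C = {x \<in> N y. \<phi> x = j}" if "y \<in> Y" for y
    using N[OF that] by (auto simp: C_def Cl_def)
  have finH: "finite H" using fin by (simp add: H_def)
  have L: "finite (N y \<inter> C) \<and> N y \<inter> C \<noteq> {}" if "y \<in> H" for y
    using that D0[of y] finN[of y] by (auto simp: H_def)
  \<comment> \<open>One choice \<open>g\<close> must serve all sets \<open>T i\<close> at once, so a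
    pair is weighted by the number of sets containing it.\<close>
  define \<kappa> where "\<kappa> y y' = (\<Sum>i\<in>I. of_bool (y \<in> T i \<and> y' \<in> T i) :: real)" for y y'
  obtain g where g: "\<forall>y\<in>H. g y \<in> N y \<inter> C"
    and gle: "(\<Sum>y\<in>H. \<Sum>y'\<in>H - {y}. \<kappa> y y' * of_bool (g y = g y'))
      \<le> (\<Sum>y\<in>H. \<Sum>y'\<in>H - {y}. \<kappa> y y' * (card ((N y \<inter> C) \<inter> (N y' \<inter> C)) / (card (N y \<inter> C) * card (N y' \<inter> C))))"
    using averaging_choice[where L = "\<lambda>y. N y \<inter> C" and u = "\<lambda>_ _. 0" and \<kappa> = \<kappa>, OF finH L] by auto
  have swap: "(\<Sum>y\<in>H. \<Sum>y'\<in>H - {y}. \<kappa> y y' * h y y')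
      = (\<Sum>i\<in>I. \<Sum>y\<in>T i \<inter> H. \<Sum>y'\<in>T i \<inter> H - {y}. h y y')" for h
  proof -
    have "(\<Sum>y\<in>H. \<Sum>y'\<in>H - {y}. \<kappa> y y' * h y y')
        = (\<Sum>y\<in>H. \<Sum>y'\<in>H - {y}. \<Sum>i\<in>I. of_bool (y \<in> T i \<and> y' \<in> T i) * h y y')"
      by (simp only: \<kappa>_def sum_distrib_right)
    also have "\<dots> = (\<Sum>y\<in>H. \<Sum>i\<in>I. \<Sum>y'\<in>H - {y}. of_bool (y \<in> T i \<and> y' \<in> T i) * h y y')"
      by (rule sum.cong[OF refl], rule sum.swap)
    also have "\<dots> = (\<Sum>i\<in>I. \<Sum>y\<in>H. \<Sum>y'\<in>H - {y}. of_bool (y \<in> T i \<and> y' \<in> T i) * h y y')"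
      by (rule sum.swap)
    also have "\<dots> = (\<Sum>i\<in>I. \<Sum>y\<in>T i \<inter> H. \<Sum>y'\<in>T i \<inter> H - {y}. h y y')"
    proof (rule sum.cong[OF refl])
      fix i
      have "(\<Sum>y\<in>H. \<Sum>y'\<in>H - {y}. of_bool (y \<in> T i \<and> y' \<in> T i) * h y y')
          = (\<Sum>y\<in>T i \<inter> H. \<Sum>y'\<in>H - {y}. of_bool (y \<in> T i \<and> y' \<in> T i) * h y y')"
        using finH by (intro sum.mono_neutral_right ballI sum.neutral) auto
      also have "\<dots> = (\<Sum>y\<in>T i \<inter> H. \<Sum>y'\<in>T i \<inter> H - {y}. h y y')"
        using finH by (intro sum.cong refl sum.mono_neutral_cong_right) auto
      finally show "(\<Sum>y\<in>H. \<Sum>y'\<in>H - {y}. of_bool (y \<in> T i \<and> y' \<in> T i) * h y y')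
          = (\<Sum>y\<in>T i \<inter> H. \<Sum>y'\<in>T i \<inter> H - {y}. h y y')" .
    qed
    finally show ?thesis .
  qed
  have "(\<Sum>i\<in>I. \<Sum>y\<in>T i \<inter> H. \<Sum>y'\<in>T i \<inter> H - {y}. of_bool (g y = g y'))
      \<le> (\<Sum>i\<in>I. \<Sum>y\<in>T i \<inter> H. \<Sum>y'\<in>T i \<inter> H - {y}.
          card ((N y \<inter> C) \<inter> (N y' \<inter> C)) / (card (N y \<inter> C) * card (N y' \<inter> C)))"
    using gle unfolding swap .
  \<comment> \<open>Restricting the choice to \<open>C\<close> shrinks each of the two
    neighbourhoods by a factor of at most \<open>2 * q\<close>, hence the factor
    \<open>4 * q^2\<close>.\<close>
  also have "\<dots> \<le> (\<Sum>i\<in>I. \<Sum>y\<in>T i \<inter> H. \<Sum>y'\<in>T i \<inter> H - {y}.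
      4 * (real q)\<^sup>2 * (card (N y \<inter> N y' \<inter> C) / (?D y * ?D y')))"
  proof (intro sum_mono)
    fix i y y' assume "y \<in> T i \<inter> H" "y' \<in> T i \<inter> H - {y}"
    then have y: "y \<in> H" "y' \<in> H" by auto
    have le: "?D z \<le> 2 * real q * card (N z \<inter> C)" "0 < ?D z" if "z \<in> H" for z
    proof -
      have "card (N z) \<le> 2 * q * card (N z \<inter> C)" using that by (simp add: H_def)
      from of_nat_mono[OF this, where 'a=real] show "?D z \<le> 2 * real q * card (N z \<inter> C)" by simp
      show "0 < ?D z" using that D0 by (simp add: H_def)
    qed
    have "?D y * ?D y' \<le> (2 * real q * card (N y \<inter> C)) * (2 * real q * card (N y' \<inter> C))"
      using le y by (intro mult_mono) auto
    then have *: "?D y * ?D y' \<le> 4 * (real q)\<^sup>2 * (real (card (N y \<inter> C)) * card (N y' \<inter> C))"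
      by (simp add: power2_eq_square mult_ac)
    have pos: "0 < real (card (N y \<inter> C)) * card (N y' \<inter> C)"
      using L y by (auto simp: card_gt_0_iff)
    have "1 / (real (card (N y \<inter> C)) * card (N y' \<inter> C)) \<le> 4 * (real q)\<^sup>2 / (?D y * ?D y')"
      using * pos le y by (simp add: field_simps)
    then have "card (N y \<inter> N y' \<inter> C) * (1 / (real (card (N y \<inter> C)) * card (N y' \<inter> C)))
        \<le> card (N y \<inter> N y' \<inter> C) * (4 * (real q)\<^sup>2 / (?D y * ?D y'))"
      by (intro mult_left_mono) auto
    moreover have "(N y \<inter> C) \<inter> (N y' \<inter> C) = N y \<inter> N y' \<inter> C" by auto
    ultimately show "card ((N y \<inter> C) \<inter> (N y' \<inter> C)) / (card (N y \<inter> C) * card (N y' \<inter> C))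
        \<le> 4 * (real q)\<^sup>2 * (card (N y \<inter> N y' \<inter> C) / (?D y * ?D y'))"
      by (simp add: mult_ac)
  qed
  also have "\<dots> \<le> (\<Sum>i\<in>I. \<Sum>y\<in>T i. \<Sum>y'\<in>T i - {y}. 4 * (real q)\<^sup>2 * (card (N y \<inter> N y' \<inter> C) / (?D y * ?D y')))"
  proof (rule sum_mono)
    fix i assume i: "i \<in> I"
    have "(\<Sum>y\<in>T i \<inter> H. \<Sum>y'\<in>T i \<inter> H - {y}. 4 * (real q)\<^sup>2 * (card (N y \<inter> N y' \<inter> C) / (?D y * ?D y')))
        \<le> (\<Sum>y\<in>T i \<inter> H. \<Sum>y'\<in>T i - {y}. 4 * (real q)\<^sup>2 * (card (N y \<inter> N y' \<inter> C) / (?D y * ?D y')))"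
      using finT[OF i] by (intro sum_mono sum_mono2) auto
    also have "\<dots> \<le> (\<Sum>y\<in>T i. \<Sum>y'\<in>T i - {y}. 4 * (real q)\<^sup>2 * (card (N y \<inter> N y' \<inter> C) / (?D y * ?D y')))"
      using finT[OF i] by (intro sum_mono2 sum_nonneg) auto
    finally show "(\<Sum>y\<in>T i \<inter> H. \<Sum>y'\<in>T i \<inter> H - {y}. 4 * (real q)\<^sup>2 * (card (N y \<inter> N y' \<inter> C) / (?D y * ?D y')))
        \<le> (\<Sum>y\<in>T i. \<Sum>y'\<in>T i - {y}. 4 * (real q)\<^sup>2 * (card (N y \<inter> N y' \<inter> C) / (?D y * ?D y')))" .
  qed
  also have "\<dots> = 4 * (real q)\<^sup>2 * f4 j"
    by (simp only: f4_def C_def sum_distrib_left)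
  also have "\<dots> \<le> 4 * (real q)\<^sup>2 * (4 * (n / (64 * (real q)\<^sup>2)))"
    using j by (intro mult_left_mono) auto
  also have "\<dots> = n / 4" using q0 by simp
  finally have colls: "(\<Sum>i\<in>I. \<Sum>y\<in>T i \<inter> H. \<Sum>y'\<in>T i \<inter> H - {y}. of_bool (g y = g y')) \<le> n / 4" .
  \<comment> \<open>A pair outside all \<open>B i\<close> has lost its leaf to \<open>C\<close> or
    has its \<open>y\<close> outside \<open>H\<close>.\<close>
  have "n - f2 j - f3 j \<le> (\<Sum>i\<in>I. real (card (B i)))"
  proof -
    let ?S2 = "{p \<in> P. \<phi> (\<xi> (fst p) (snd p)) = j}"
    let ?S3 = "{p \<in> P. 2 * q * card {x \<in> N (snd p). \<phi> x = j} < card (N (snd p))}"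
    have "P \<subseteq> (SIGMA i:I. B i) \<union> ?S2 \<union> ?S3"
    proof
      fix p assume "p \<in> P"
      then obtain i y where p: "p = (i, y)" "i \<in> I" "y \<in> T i" by (auto simp: P_def)
      then have "y \<in> Y" using T by auto
      then show "p \<in> (SIGMA i:I. B i) \<union> ?S2 \<union> ?S3"
        using p \<open>p \<in> P\<close> \<xi>[OF p(2,3)] NC by (auto simp: B_def H_def C_def Cl_def not_less)
    qed
    moreover have finB: "finite (B i)" if "i \<in> I" for i
      using finT[OF that] by (simp add: B_def)
    ultimately have "card P \<le> card ((SIGMA i:I. B i) \<union> ?S2 \<union> ?S3)"
      using finP fin by (intro card_mono) auto
    also have "\<dots> \<le> card (SIGMA i:I. B i) + card ?S2 + card ?S3"
      using card_Un_le[of "(SIGMA i:I. B i) \<union> ?S2" ?S3] card_Un_le[of "SIGMA i:I. B i" ?S2] by linarith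
    also have "card (SIGMA i:I. B i) = (\<Sum>i\<in>I. card (B i))"
      using fin finB by simp
    finally have "card P \<le> (\<Sum>i\<in>I. card (B i)) + card ?S2 + card ?S3" .
    from of_nat_mono[OF this, where 'a=real] show ?thesis
      by (simp add: cardP f2_def f3_def)
  qed
  \<comment> \<open>Here q \<ge> 40 is used, and d \<ge> 160 q for \<open>f3\<close>. The two losses
    leave more than n / 2 pairs, of which at most n / 4 are then lost to collisions.\<close>
  moreover have "f2 j \<le> n / 10"
  proof -
    have "4 * (n / q) \<le> 4 * (n / 40)" using q n0 by (intro mult_left_mono divide_left_mono) auto
    then show ?thesis using j by linarith
  qed
  moreover have "f3 j \<le> n / 10"
  proof -
    have "160 * real q \<le> d" using of_nat_mono[OF d, where 'a=real] by simp
    then have "16 * q * n \<le> (d / 10) * n" using n0 by (intro mult_right_mono) auto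
    then have "4 * (4 * q * n / d) \<le> n / 10" using d0 by (simp add: field_simps)
    then show ?thesis using j by linarith
  qed
  ultimately have "n / 2 \<le> (\<Sum>i\<in>I. real (card (B i)))" using n0 by linarith
  moreover have "(\<Sum>i\<in>I. real (card (B i))) - n / 4 \<le> (\<Sum>i\<in>I. real (card (g ` B i)))"
  proof -
    have "real (card (B i)) - (\<Sum>y\<in>T i \<inter> H. \<Sum>y'\<in>T i \<inter> H - {y}. of_bool (g y = g y')) \<le> card (g ` B i)"
      if i: "i \<in> I" for i
    proof -
      have finB: "finite (B i)" using finT[OF that] by (simp add: B_def)
      have sub: "B i \<subseteq> T i \<inter> H" by (auto simp: B_def)
      have "(\<Sum>y\<in>B i. \<Sum>y'\<in>B i - {y}. of_bool (g y = g y') :: real)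
          \<le> (\<Sum>y\<in>B i. \<Sum>y'\<in>T i \<inter> H - {y}. of_bool (g y = g y'))"
        using sub finT[OF i] by (intro sum_mono sum_mono2) auto
      also have "\<dots> \<le> (\<Sum>y\<in>T i \<inter> H. \<Sum>y'\<in>T i \<inter> H - {y}. of_bool (g y = g y'))"
        using sub finT[OF i] by (intro sum_mono2 sum_nonneg) auto
      finally show ?thesis using card_image_ge_collisions[OF finB, of g] by linarith
    qed
    then have "(\<Sum>i\<in>I. real (card (B i)) - (\<Sum>y\<in>T i \<inter> H. \<Sum>y'\<in>T i \<inter> H - {y}. of_bool (g y = g y')))
        \<le> (\<Sum>i\<in>I. real (card (g ` B i)))"
      by (intro sum_mono)
    then show ?thesis using colls by (simp only: sum_subtractf)
  qed
  ultimately have res: "n / 4 \<le> (\<Sum>i\<in>I. real (card (g ` B i)))" by linarith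
  have "C \<noteq> {}"
  proof
    assume "C = {}"
    then have "B i = {}" for i using L by (auto simp: B_def)
    then show False using res n0 by simp
  qed
  moreover have "real q * card C \<le> 4 * card X"
    using j(2) q0 by (simp add: f1_def C_def field_simps)
  ultimately show ?thesis
    using C g res unfolding B_def n_def
    by (intro exI[of _ C] exI[of _ g] exI[of _ H]) (auto simp: H_def)
qed

subsection \<open>Contracting stars\<close>

text \<open>All branch sets are stars, and each is represented by its centre. The adjacent pairs are
  ordered, so \<open>\<delta>\<close> is a bound for the average degree.\<close>

definition has_star_minor :: "'a rel \<Rightarrow> 'a set \<Rightarrow> real \<Rightarrow> bool" where
  "has_star_minor E V \<delta> \<longleftrightarrow> (\<exists>P b. P \<subseteq> V \<and> P \<noteq> {} \<and>
     (\<forall>c\<in>P. c \<in> b c \<and> b c \<subseteq> insert c (E `` {c})) \<and> disjoint_family_on b P \<and>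
     \<delta> * card P \<le> card {(c, e). c \<in> P \<and> e \<in> P \<and> c \<noteq> e \<and> (\<exists>x\<in>b c. \<exists>y\<in>b e. (x, y) \<in> E)})"

section \<open>Star minors in graphs with few common neighbours\<close>

text \<open>The excluded complete bipartite graph enters only through \<open>free\<close>, a bound
  on the common neighbours of \<open>s\<close> vertices, the form needed in every double
  count.\<close>

locale sparse_graph =
  fixes V :: "'a set" and E :: "'a rel" and s k :: nat
  assumes finV: "finite V" and E: "E \<subseteq> V \<times> V" and symE: "sym E"
    and s: "2 \<le> s" and k: "1 \<le> k"
    and free: "\<And>A. A \<subseteq> V \<Longrightarrow> card A = s \<Longrightarrow> card {y \<in> V. A \<subseteq> E `` {y}} \<le> k"
begin

lemma sum_degrees_commute:
  assumes "finite S" "finite T"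
  shows "(\<Sum>x\<in>S. card (E `` {x} \<inter> T)) = (\<Sum>y\<in>T. card (E `` {y} \<inter> S))"
proof -
  have eq: "card (E `` {x} \<inter> B) = (\<Sum>y\<in>B. of_bool ((x, y) \<in> E))" if "finite B" for x B
  proof -
    have "E `` {x} \<inter> B = B \<inter> {y. (x, y) \<in> E}" by auto
    then show ?thesis using that by simp
  qed
  have "(\<Sum>x\<in>S. card (E `` {x} \<inter> T)) = (\<Sum>x\<in>S. \<Sum>y\<in>T. of_bool ((x, y) \<in> E))"
    using eq[OF assms(2)] by simp
  also have "\<dots> = (\<Sum>y\<in>T. \<Sum>x\<in>S. of_bool ((x, y) \<in> E))" by (rule sum.swap)
  also have "\<dots> = (\<Sum>y\<in>T. \<Sum>x\<in>S. of_bool ((y, x) \<in> E))"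
    using symE by (intro sum.cong refl) (auto simp: sym_def)
  also have "\<dots> = (\<Sum>y\<in>T. card (E `` {y} \<inter> S))"
    using eq[OF assms(1)] by simp
  finally show ?thesis .
qed

lemma free_subset:
  assumes "A \<subseteq> V" "card A = s" "T \<subseteq> V"
  shows "card {y \<in> T. A \<subseteq> E `` {y}} \<le> k"
proof -
  have "card {y \<in> T. A \<subseteq> E `` {y}} \<le> card {y \<in> V. A \<subseteq> E `` {y}}"
    using assms finV by (intro card_mono) auto
  then show ?thesis using free[OF assms(1,2)] by linarith
qed

text \<open>Smallness of \<open>S\<close> makes the error term of the double counting at most half
  of the edges leaving \<open>S\<close>; the other half must reach distinct vertices, up to a factor
  \<open>s\<close>.\<close>

lemma card_nbrs_ge:
  fixes d :: real
  assumes "S \<subseteq> V" "T \<subseteq> V" and deg: "\<And>x. x \<in> S \<Longrightarrow> d \<le> card (E `` {x} \<inter> T)"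
    and small: "2 * real s ^ s * k * real (card S) ^ (s - 1) \<le> d"
  shows "card S * d \<le> 2 * real s * card {y \<in> T. E `` {y} \<inter> S \<noteq> {}}"
proof -
  have fin: "finite S" "finite T" using assms finV by (auto intro: finite_subset)
  have "card S * d = (\<Sum>x\<in>S. d)" by simp
  also have "\<dots> \<le> (\<Sum>x\<in>S. real (card (E `` {x} \<inter> T)))" using deg by (rule sum_mono)
  also have "\<dots> = real (\<Sum>y\<in>T. card (E `` {y} \<inter> S))"
    using sum_degrees_commute[OF fin] by (simp flip: of_nat_sum)
  also have "\<dots> \<le> s * real (card {y \<in> T. E `` {y} \<inter> S \<noteq> {}}) + real s ^ s * k * real (card S) ^ s"
    using s assms(1,2) by (intro sum_card_le_distinct fin free_subset) auto
  also have "real s ^ s * k * real (card S) ^ s \<le> card S * d / 2"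
  proof -
    have "real (card S) ^ s = real (card S) ^ (s - 1) * card S"
      using s by (cases s) auto
    moreover have "(2 * real s ^ s * k * real (card S) ^ (s - 1)) * card S \<le> d * card S"
      using small by (intro mult_right_mono) auto
    ultimately show ?thesis by (simp add: mult_ac)
  qed
  finally show ?thesis by simp
qed

lemma star_minor_of_few_centres:
  fixes m d :: nat
  assumes XZ: "X \<subseteq> V" "Z \<subseteq> V" "X \<inter> Z = {}" "Z \<noteq> {}" and m: "0 < m" and md: "8 * s \<le> m * d"
    and deg: "\<And>x. x \<in> X \<Longrightarrow> d \<le> card (E `` {x} \<inter> Z)" and many: "5 * m * card Z \<le> card X"
    and small: "4 * real s ^ s * k * real m ^ (s - 1) \<le> d"
  shows "has_star_minor E V (m * d / (16 * s))"
proof -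
  have fin: "finite X" "finite Z" using XZ finV by (auto intro: finite_subset)
  have d0: "0 < d" using md s by (cases d) auto
  \<comment> \<open>Trimming to exactly \<open>d\<close> edges at each \<open>x\<close> provides the
    upper bound on degrees needed to count edges at the used leaves.\<close>
  have "\<forall>x\<in>X. \<exists>r. r \<subseteq> E `` {x} \<inter> Z \<and> card r = d"
    using deg by (meson obtain_subset_with_card_n)
  then obtain r where r: "\<And>x. x \<in> X \<Longrightarrow> r x \<subseteq> E `` {x} \<inter> Z" "\<And>x. x \<in> X \<Longrightarrow> card (r x) = d"
    by metis
  have finr: "finite (r x)" if "x \<in> X" for x using r[OF that] fin by (auto intro: finite_subset)
  define R where "R = (SIGMA x:X. r x)"
  have Rsub: "R \<subseteq> X \<times> Z" using r by (auto simp: R_def)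
  have cR: "card R = card X * d" using r fin finr by (simp add: R_def)
  have "0 < card Z" using XZ fin by (simp add: card_gt_0_iff)
  then have X0: "0 < card X" using many m by (metis mult_pos_pos not_le zero_less_numeral le_zero_eq neq0_conv)
  have nonneg: "0 \<le> real d / 2" "0 \<le> 2 * real m * d" by simp_all
  have Rcard: "real d / 2 * card X + 2 * real m * d * card Z < card R"
  \<comment> \<open>The thresholds cost d |X| / 2 and 2 m d |Z|. The second is at most 2/5 of d |X|,
    so together they stay below the d |X| edges of \<open>R\<close>.\<close>
  proof -
    have "5 * real m * card Z \<le> card X" using of_nat_mono[OF many, where 'a=real] by simp
    then have "(2 / 5 * real d) * (5 * real m * card Z) \<le> (2 / 5 * real d) * card X"
      by (intro mult_left_mono) auto
    moreover have "0 < real d * card X" using d0 X0 by simp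
    ultimately show ?thesis unfolding cR by (simp add: algebra_simps)
  qed
  obtain X' Z' where X'Z': "X' \<subseteq> X" "Z' \<subseteq> Z" "X' \<noteq> {}" "Z' \<noteq> {}"
    and dX: "\<And>x. x \<in> X' \<Longrightarrow> real d / 2 \<le> card (R `` {x} \<inter> Z')"
    and dZ: "\<And>z. z \<in> Z' \<Longrightarrow> 2 * real m * d \<le> card (R\<inverse> `` {z} \<inter> X')"
    using bipartite_min_degree_core[OF fin Rsub nonneg Rcard] by blast
  have fin': "finite X'" "finite Z'" using X'Z' fin by (auto intro: finite_subset)
  define N where "N z = R\<inverse> `` {z} \<inter> X'" for z
  obtain Z1 S where Z1: "Z1 \<subseteq> Z'" and S: "\<And>z. z \<in> Z1 \<Longrightarrow> S z \<subseteq> N z" "\<And>z. z \<in> Z1 \<Longrightarrow> card (S z) = m"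
    and disj: "disjoint_family_on S Z1"
    and maxi: "\<And>z. z \<in> Z' - Z1 \<Longrightarrow> finite (N z) \<Longrightarrow> card (N z - \<Union> (S ` Z1)) < m"
    using star_packing[OF fin'(2), of N m] by blast
  define W where "W = \<Union> (S ` Z1)"
  have finZ1: "finite Z1" using Z1 fin' by (auto intro: finite_subset)
  have WX: "W \<subseteq> X'" using S by (auto simp: W_def N_def)
  have finW: "finite W" using WX fin' by (auto intro: finite_subset)
  have cW: "card W \<le> m * card Z1"
    unfolding W_def using card_UN_le[OF finZ1, of S] S(2) by (simp add: mult.commute)
  have "card (Z' - Z1) * (m * d) \<le> card Z1 * (m * d)"
  proof -
    \<comment> \<open>By maximality fewer than \<open>m\<close> of the at least
      \<open>2 * m * d\<close> neighbours lie outside \<open>W\<close>.\<close>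
    have "m * d \<le> card (N u \<inter> W)" if u: "u \<in> Z' - Z1" for u
    proof -
      have finN: "finite (N u)" using fin' by (simp add: N_def)
      have "real (2 * m * d) \<le> card (N u)" using dZ u by (simp add: N_def)
      then have 1: "2 * m * d \<le> card (N u)" by linarith
      have 2: "card (N u - W) < m" using maxi[OF u finN] by (simp add: W_def)
      have 3: "card (N u) = card (N u \<inter> W) + card (N u - W)"
        using finN card_Diff_subset_Int[of "N u" W] card_mono[of "N u" "N u \<inter> W"] by simp
      have "m \<le> m * d" using d0 by simp
      then show ?thesis using 1 2 3 by (simp only: mult.assoc)
    qed
    then have "card (Z' - Z1) * (m * d) \<le> (\<Sum>u\<in>Z' - Z1. card (N u \<inter> W))"
      using sum_mono[of "Z' - Z1" "\<lambda>_. m * d" "\<lambda>u. card (N u \<inter> W)"] by simp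
    also have "\<dots> \<le> (\<Sum>u\<in>Z' - Z1. \<Sum>x\<in>W. of_bool (u \<in> r x))"
    proof (rule sum_mono)
      fix u
      have "N u \<inter> W \<subseteq> W \<inter> {x. u \<in> r x}" by (auto simp: N_def R_def)
      then have "card (N u \<inter> W) \<le> card (W \<inter> {x. u \<in> r x})" using finW by (intro card_mono) auto
      then show "card (N u \<inter> W) \<le> (\<Sum>x\<in>W. of_bool (u \<in> r x))" using finW by simp
    qed
    also have "\<dots> = (\<Sum>x\<in>W. \<Sum>u\<in>Z' - Z1. of_bool (u \<in> r x))" by (rule sum.swap)
    also have "\<dots> \<le> (\<Sum>x\<in>W. d)"
    proof (rule sum_mono)
      fix x assume "x \<in> W"
      then have x: "x \<in> X" using WX X'Z' by auto
      have "(\<Sum>u\<in>Z' - Z1. of_bool (u \<in> r x)) = card ((Z' - Z1) \<inter> r x)" using fin' by simp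
      also have "\<dots> \<le> card (r x)" using finr[OF x] by (intro card_mono) auto
      finally show "(\<Sum>u\<in>Z' - Z1. of_bool (u \<in> r x)) \<le> d" using r(2)[OF x] by simp
    qed
    also have "\<dots> \<le> m * card Z1 * d" using cW by simp
    finally show ?thesis by (simp add: mult_ac)
  qed
  then have "card (Z' - Z1) \<le> card Z1" using m d0 by simp
  moreover have "card Z' = card Z1 + card (Z' - Z1)"
    using Z1 fin' finZ1 by (simp add: card_Diff_subset card_mono)
  ultimately have Z12: "card Z' \<le> 2 * card Z1" by simp
  define T where "T z = {y \<in> Z'. E `` {y} \<inter> S z \<noteq> {}}" for z
  \<comment> \<open>The centre itself may be among the vertices seen; m d \<ge> 8 s makes this loss
    of one at most half of m d / (4 s).\<close>
  have Tge: "m * d / (8 * s) \<le> real (card (T z - {z}))" if z: "z \<in> Z1" for z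
  proof -
    have SX: "S z \<subseteq> X'" using S(1)[OF z] by (auto simp: N_def)
    have "card (S z) * (d / 2) \<le> 2 * real s * card {y \<in> Z'. E `` {y} \<inter> S z \<noteq> {}}"
    proof (rule card_nbrs_ge)
      fix x assume "x \<in> S z"
      then have x: "x \<in> X'" using SX by auto
      have "R `` {x} \<inter> Z' \<subseteq> E `` {x} \<inter> Z'" using r(1) by (auto simp: R_def)
      then have "card (R `` {x} \<inter> Z') \<le> card (E `` {x} \<inter> Z')" using fin' by (intro card_mono) auto
      then show "d / 2 \<le> card (E `` {x} \<inter> Z')" using dX[OF x] by linarith
    next
      show "2 * real s ^ s * k * real (card (S z)) ^ (s - 1) \<le> d / 2"
        using small S(2)[OF z] by simp
    qed (use SX X'Z' XZ in auto)
    then have "m * d / (4 * s) \<le> card (T z)"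
      using s S(2)[OF z] by (simp add: T_def field_simps)
    moreover have "1 \<le> m * d / (8 * s)"
      using of_nat_mono[OF md, where 'a=real] s by (simp add: field_simps)
    moreover have "m * d / (4 * s) = m * d / (8 * s) + m * d / (8 * s)" by simp
    moreover have "card (T z) \<le> card (T z - {z}) + 1"
      by (cases "z \<in> T z") (auto simp: card_Diff_singleton_if)
    ultimately show ?thesis by linarith
  qed
  define b where "b z = (if z \<in> Z1 then insert z (S z) else {z})" for z
  have SX: "S z \<subseteq> X" if "z \<in> Z1" for z using S(1)[OF that] X'Z' by (auto simp: N_def)
  have SE: "S z \<subseteq> E `` {z}" if "z \<in> Z1" for z
    using S(1)[OF that] r(1) symE by (fastforce simp: N_def R_def sym_def)
  have Z'X: "z \<notin> X" if "z \<in> Z'" for z using that X'Z' XZ by auto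
  let ?A = "{(c, e). c \<in> Z' \<and> e \<in> Z' \<and> c \<noteq> e \<and> (\<exists>x\<in>b c. \<exists>y\<in>b e. (x, y) \<in> E)}"
  have finA: "finite ?A" by (rule finite_subset[of _ "Z' \<times> Z'"]) (use fin' in auto)
  have "m * d / (16 * s) * card Z' \<le> m * d / (16 * s) * (2 * real (card Z1))"
    using of_nat_mono[OF Z12, where 'a=real] by (intro mult_left_mono) auto
  also have "\<dots> = (\<Sum>z\<in>Z1. m * d / (8 * s))" by simp
  also have "\<dots> \<le> (\<Sum>z\<in>Z1. real (card (T z - {z})))" using Tge by (rule sum_mono)
  also have "\<dots> = card (SIGMA z:Z1. T z - {z})" using finZ1 fin' by (simp add: T_def)
  also have "\<dots> \<le> card ?A"
  proof (intro of_nat_mono card_mono finA subsetI)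
    fix p assume "p \<in> (SIGMA z:Z1. T z - {z})"
    then obtain z y x where p: "p = (z, y)" "z \<in> Z1" "y \<in> Z'" "y \<noteq> z" "(y, x) \<in> E" "x \<in> S z"
      by (auto simp: T_def)
    moreover have "(x, y) \<in> E" using p symE by (auto simp: sym_def)
    moreover have "x \<in> b z" "y \<in> b y" using p by (auto simp: b_def)
    ultimately show "p \<in> ?A" using Z1 by auto
  qed
  finally have le: "m * d / (16 * s) * card Z' \<le> card ?A" .
  have "disjoint_family_on b Z'"
    unfolding disjoint_family_on_def
  proof (intro ballI impI)
    fix z w assume zw: "z \<in> Z'" "w \<in> Z'" "z \<noteq> w"
    have "S z \<inter> S w = {}" if "z \<in> Z1" "w \<in> Z1"
      using disj zw that by (auto simp: disjoint_family_on_def)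
    then show "b z \<inter> b w = {}"
      using SX[of z] SX[of w] Z'X[OF zw(1)] Z'X[OF zw(2)] zw(3) unfolding b_def by (auto split: if_splits)
  qed
  moreover have "\<forall>c\<in>Z'. c \<in> b c \<and> b c \<subseteq> insert c (E `` {c})"
    using SE by (auto simp: b_def)
  ultimately show ?thesis
    unfolding has_star_minor_def using le X'Z' XZ
    by (intro exI[of _ Z'] exI[of _ b]) auto
qed

text \<open>Either many vertices send at least \<open>d\<close> edges to the centres
  \<open>Z\<close> of a maximal packing, and \<open>Z\<close> is small enough for the previous
  construction, or most stars see many vertices of \<open>Y - Z\<close>, which are then grouped
  around few centres in \<open>X\<close>. The constant 102400 is 128 * 40 * 20: density parameter
  \<open>40 * m\<close>, stars with \<open>20 * m\<close> leaves.\<close>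

lemma star_minor_of_bipartite:
  fixes m d :: nat
  assumes XY: "X \<subseteq> V" "Y \<subseteq> V" "X \<inter> Y = {}" "X \<noteq> {}" "card Y \<le> card X"
    and degX: "\<And>x. x \<in> X \<Longrightarrow> 2 * d \<le> card (E `` {x} \<inter> Y)"
    and degY: "\<And>y. y \<in> Y \<Longrightarrow> 2 * d \<le> card (E `` {y} \<inter> X)"
    and m: "0 < m" and large: "102400 ^ (s - 1) * s ^ s * k * m ^ (2 * (s - 1)) \<le> d"
  shows "has_star_minor E V (m * d / (16 * s))"
proof -
  have fin: "finite X" "finite Y" using XY finV by (auto intro: finite_subset)
  have m1: "1 \<le> m" using m by simp
  \<comment> \<open>\<open>F1\<close> is the smallness condition for counting neighbours of
    \<open>20 * m\<close> leaves, \<open>F2\<close> the degree condition of the collision bound with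
    \<open>q = 40 * m\<close>.\<close>
  have F1: "4 * s ^ s * k * (20 * m) ^ (s - 1) \<le> d"
  proof -
    have "4 * 20 ^ (s - 1) \<le> (102400::nat) ^ (s - 1)"
    proof -
      have "4 ^ 1 \<le> (4::nat) ^ (s - 1)" using s by (intro power_increasing) auto
      then have "4 * 20 ^ (s - 1) \<le> (4::nat) ^ (s - 1) * 20 ^ (s - 1)" by simp
      also have "\<dots> = 80 ^ (s - 1)" by (simp flip: power_mult_distrib)
      also have "\<dots> \<le> 102400 ^ (s - 1)" by (intro power_mono) auto
      finally show ?thesis .
    qed
    moreover have "m ^ (s - 1) \<le> m ^ (2 * (s - 1))" using m1 by (intro power_increasing) auto
    ultimately have "(4 * 20 ^ (s - 1)) * (s ^ s * k) * m ^ (s - 1) \<le> 102400 ^ (s - 1) * (s ^ s * k) * m ^ (2 * (s - 1))"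
      by (intro mult_mono) auto
    then have "(4 * 20 ^ (s - 1)) * (s ^ s * k) * m ^ (s - 1) \<le> d"
      using large by (simp only: mult.assoc)
    then show ?thesis by (simp only: power_mult_distrib mult_ac)
  qed
  have F2: "128 * (40 * m) * s \<le> d"
  proof -
    have "(102400::nat) ^ 1 \<le> 102400 ^ (s - 1)" using s by (intro power_increasing) auto
    moreover have "s ^ 1 \<le> s ^ s" using s by (intro power_increasing) auto
    moreover have "m ^ 1 \<le> m ^ (2 * (s - 1))" using m1 s by (intro power_increasing) auto
    ultimately have "102400 * s * 1 * m \<le> 102400 ^ (s - 1) * s ^ s * k * m ^ (2 * (s - 1))"
      using k by (intro mult_mono) auto
    then have "102400 * s * 1 * m \<le> d" using large by (rule le_trans)
    moreover have "128 * (40 * m) * s \<le> 102400 * s * 1 * m" by (simp add: mult_ac)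
    ultimately show ?thesis by linarith
  qed
  have ds: "5120 * s \<le> d" "10240 * m \<le> d"
  proof -
    have "5120 * (m * s) \<le> d" using F2 by (simp only: mult_ac)
    moreover have "s \<le> m * s" "2 * m \<le> m * s" using m1 s by simp_all
    ultimately show "5120 * s \<le> d" "10240 * m \<le> d" by linarith+
  qed
  then have d0: "0 < d" using m by linarith
  have md: "5120 * s \<le> m * d"
  proof -
    have "d \<le> m * d" using m by simp
    then show ?thesis using ds(1) by linarith
  qed
  have F1r: "4 * real s ^ s * k * real (20 * m) ^ (s - 1) \<le> d"
    using of_nat_mono[OF F1, where 'a=real] by simp
  define N where "N y = E `` {y} \<inter> X" for y
  have finN: "finite (N y)" for y using fin by (simp add: N_def)
  obtain Z S where Z: "Z \<subseteq> Y" and S: "\<And>z. z \<in> Z \<Longrightarrow> S z \<subseteq> N z" "\<And>z. z \<in> Z \<Longrightarrow> card (S z) = 40 * m"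
    and disj: "disjoint_family_on S Z"
    and maxi: "\<And>z. z \<in> Y - Z \<Longrightarrow> card (N z - \<Union> (S ` Z)) < 40 * m"
    using star_packing[OF fin(2), of N "40 * m"] finN by blast
  have finZ: "finite Z" using Z fin by (auto intro: finite_subset)
  define W where "W = \<Union> (S ` Z)"
  have SX: "S z \<subseteq> X" if "z \<in> Z" for z using S(1)[OF that] by (auto simp: N_def)
  have finS: "finite (S z)" if "z \<in> Z" for z using SX[OF that] fin by (auto intro: finite_subset)
  have cW: "card W \<le> 40 * m * card Z"
    unfolding W_def using card_UN_le[OF finZ, of S] S(2) by (simp add: mult.commute)
  define X3 where "X3 = {x \<in> X. d \<le> card (E `` {x} \<inter> Z)}"
  have finX3: "finite X3" using fin by (simp add: X3_def)
  show ?thesis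
  proof (cases "Z \<noteq> {} \<and> 5 * m * card Z \<le> card X3")
    case True
    show ?thesis
    proof (rule star_minor_of_few_centres[of X3 Z])
      have "real m ^ (s - 1) \<le> real (20 * m) ^ (s - 1)" by (intro power_mono) auto
      then have "4 * real s ^ s * k * real m ^ (s - 1) \<le> 4 * real s ^ s * k * real (20 * m) ^ (s - 1)"
        by (intro mult_left_mono) auto
      then show "4 * real s ^ s * k * real m ^ (s - 1) \<le> d" using F1r by linarith
    qed (use True XY Z m md in \<open>auto simp: X3_def\<close>)
  next
    case False
    have X3Z: "card X3 \<le> 5 * m * card Z"
    proof (cases "Z = {}")
      case True
      then have "X3 = {}" using d0 by (auto simp: X3_def)
      then show ?thesis by simp
    qed (use False in auto)
    \<comment> \<open>\<open>X\<close> is covered by the star leaves \<open>W\<close>, the set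
      \<open>X3\<close> and this remainder, which turns out to be negligible.\<close>
    define X2 where "X2 = X - W - X3"
    have far: "d \<le> card (E `` {x} \<inter> (Y - Z))" if "x \<in> X" "x \<notin> X3" for x
    proof -
      have "card (E `` {x} \<inter> Y) \<le> card (E `` {x} \<inter> (Y - Z)) + card (E `` {x} \<inter> Z)"
      proof -
        have "E `` {x} \<inter> Y = (E `` {x} \<inter> (Y - Z)) \<union> (E `` {x} \<inter> Z)" using Z by auto
        then show ?thesis using card_Un_le by metis
      qed
      moreover have "card (E `` {x} \<inter> Z) < d" using that by (simp add: X3_def)
      ultimately show ?thesis using degX[OF that(1)] by linarith
    qed
    \<comment> \<open>Edges between \<open>X2\<close> and \<open>Y - Z\<close>: at least
      \<open>d\<close> at each vertex of \<open>X2\<close>, fewer than \<open>40 * m\<close> at each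
      vertex of \<open>Y - Z\<close> by maximality of the packing. The last comparison uses |Y|
      \<le> |X|.\<close>
    have "d * card X2 \<le> 40 * m * card X"
    proof -
      have "d * card X2 \<le> (\<Sum>x\<in>X2. card (E `` {x} \<inter> (Y - Z)))"
        using sum_mono[of X2 "\<lambda>_. d" "\<lambda>x. card (E `` {x} \<inter> (Y - Z))"] far
        by (simp add: X2_def mult.commute)
      also have "\<dots> = (\<Sum>y\<in>Y - Z. card (E `` {y} \<inter> X2))"
        using fin by (intro sum_degrees_commute) (auto simp: X2_def)
      also have "\<dots> \<le> (\<Sum>y\<in>Y - Z. 40 * m)"
      proof (rule sum_mono)
        fix y assume y: "y \<in> Y - Z"
        have "card (E `` {y} \<inter> X2) \<le> card (N y - W)"
          using finN by (intro card_mono) (auto simp: N_def X2_def)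
        then show "card (E `` {y} \<inter> X2) \<le> 40 * m" using maxi[OF y] by (simp add: W_def)
      qed
      also have "\<dots> \<le> 40 * m * card Y"
        using card_mono[OF fin(2), of "Y - Z"] by simp
      also have "\<dots> \<le> 40 * m * card X" using XY by simp
      finally show ?thesis .
    qed
    moreover have "320 * m * card X2 \<le> d * card X2" using ds by (intro mult_le_mono1) simp
    ultimately have "(40 * m) * (8 * card X2) \<le> (40 * m) * card X" by linarith
    then have X2: "8 * card X2 \<le> card X" using m by simp
    have "card X \<le> card W + card X3 + card X2"
    proof -
      have "X \<subseteq> W \<union> X3 \<union> X2" by (auto simp: X2_def)
      moreover have "W \<subseteq> X" using SX by (auto simp: W_def)
      ultimately have "card X \<le> card (W \<union> X3 \<union> X2)"
        using fin finX3 by (intro card_mono) (auto simp: X2_def intro: finite_subset)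
      then show ?thesis using card_Un_le[of "W \<union> X3" X2] card_Un_le[of W X3] by linarith
    qed
    then have XZ: "card X \<le> 80 * m * card Z" using cW X3Z X2 by linarith
    then have Z0: "Z \<noteq> {}" using XY fin by (auto simp: card_eq_0_iff)
    \<comment> \<open>The stars keeping at least half of their leaves outside \<open>X3\<close>.
      Every other star puts at least \<open>20 * m\<close> leaves into \<open>X3\<close>, which has
      at most 5 m |Z| elements, so at most a quarter of the stars is discarded.\<close>
    define I where "I = {z \<in> Z. 20 * m \<le> card (S z - X3)}"
    have finI: "finite I" using finZ by (simp add: I_def)
    have "20 * m * card (Z - I) \<le> card X3"
    proof -
      have "20 * m * card (Z - I) = (\<Sum>z\<in>Z - I. 20 * m)" by simp
      also have "\<dots> \<le> (\<Sum>z\<in>Z - I. card (S z \<inter> X3))"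
      proof (rule sum_mono)
        fix z assume z: "z \<in> Z - I"
        then have "card (S z - X3) < 20 * m" by (auto simp: I_def)
        moreover have "card (S z) = card (S z \<inter> X3) + card (S z - X3)"
          using z finS[of z] card_Diff_subset_Int[of "S z" X3] card_mono[of "S z" "S z \<inter> X3"] by simp
        ultimately show "20 * m \<le> card (S z \<inter> X3)" using S(2)[of z] z by simp
      qed
      also have "\<dots> = card (\<Union>z\<in>Z - I. S z \<inter> X3)"
        using disj finZ finX3 by (intro card_UN_disjoint[symmetric]) (auto simp: disjoint_family_on_def)
      also have "\<dots> \<le> card X3" using finX3 by (intro card_mono) auto
      finally show ?thesis .
    qed
    then have "(5 * m) * (4 * card (Z - I)) \<le> (5 * m) * card Z" using X3Z by linarith
    then have "4 * card (Z - I) \<le> card Z" using m by simp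
    moreover have "card Z = card I + card (Z - I)"
    proof -
      have "I \<subseteq> Z" by (auto simp: I_def)
      then show ?thesis using finZ finI by (simp add: card_Diff_subset card_mono)
    qed
    ultimately have IZ: "3 * card Z \<le> 4 * card I" by linarith
    then have I0: "I \<noteq> {}" using Z0 finZ by (auto simp: card_eq_0_iff)
    have "\<forall>z\<in>I. \<exists>A. A \<subseteq> S z - X3 \<and> card A = 20 * m"
    proof
      fix z assume "z \<in> I"
      then have "20 * m \<le> card (S z - X3)" by (simp add: I_def)
      then show "\<exists>A. A \<subseteq> S z - X3 \<and> card A = 20 * m" by (meson obtain_subset_with_card_n)
    qed
    then obtain L where L: "\<And>z. z \<in> I \<Longrightarrow> L z \<subseteq> S z - X3" "\<And>z. z \<in> I \<Longrightarrow> card (L z) = 20 * m"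
      by metis
    have IZ': "z \<in> Z" if "z \<in> I" for z using that by (simp add: I_def)
    have LX: "L z \<subseteq> X" if "z \<in> I" for z using L(1)[OF that] SX[OF IZ'[OF that]] by auto
    \<comment> \<open>The number of neighbours guaranteed by double counting, rounded down. All sets
      \<open>T z\<close> are cut to this common size, as the grouping requires; the rounding is paid
      for in \<open>tge\<close> by halving the bound.\<close>
    define t where "t = 20 * m * d div (2 * s)"
    have "\<forall>z\<in>I. \<exists>A. A \<subseteq> {y \<in> Y - Z. E `` {y} \<inter> L z \<noteq> {}} \<and> card A = t"
    proof
      fix z assume z: "z \<in> I"
      have "card (L z) * real d \<le> 2 * real s * card {y \<in> Y - Z. E `` {y} \<inter> L z \<noteq> {}}"
      proof (rule card_nbrs_ge)
        show "real d \<le> card (E `` {x} \<inter> (Y - Z))" if "x \<in> L z" for x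
          using far[of x] that L(1)[OF z] LX[OF z] by auto
        have "0 \<le> real s ^ s * k * real (20 * m) ^ (s - 1)" by simp
        then show "2 * real s ^ s * k * real (card (L z)) ^ (s - 1) \<le> d"
          using F1r L(2)[OF z] by simp
      qed (use LX[OF z] XY in auto)
      then have "real (20 * m * d) \<le> real (2 * s * card {y \<in> Y - Z. E `` {y} \<inter> L z \<noteq> {}})"
        using L(2)[OF z] by simp
      then have "20 * m * d \<le> 2 * s * card {y \<in> Y - Z. E `` {y} \<inter> L z \<noteq> {}}"
        by (simp only: of_nat_le_iff)
      then have "t \<le> (2 * s * card {y \<in> Y - Z. E `` {y} \<inter> L z \<noteq> {}}) div (2 * s)"
        unfolding t_def by (rule div_le_mono)
      also have "\<dots> = card {y \<in> Y - Z. E `` {y} \<inter> L z \<noteq> {}}"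
        by (rule nonzero_mult_div_cancel_left) (use s in simp)
      finally obtain A where "A \<subseteq> {y \<in> Y - Z. E `` {y} \<inter> L z \<noteq> {}}" "card A = t"
        by (rule obtain_subset_with_card_n)
      then show "\<exists>A. A \<subseteq> {y \<in> Y - Z. E `` {y} \<inter> L z \<noteq> {}} \<and> card A = t" by blast
    qed
    from bchoice[OF this] obtain T
      where T': "\<forall>z\<in>I. T z \<subseteq> {y \<in> Y - Z. E `` {y} \<inter> L z \<noteq> {}} \<and> card (T z) = t" ..
    have T: "T z \<subseteq> {y \<in> Y - Z. E `` {y} \<inter> L z \<noteq> {}}" "card (T z) = t" if "z \<in> I" for z
      using bspec[OF T' that] by simp_all
    have tge: "5 * real m * d / s \<le> t"
    proof -
      have "20 * m * d < 2 * s * (t + 1)"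
        unfolding t_def using s dividend_less_div_times[of "2 * s" "20 * m * d"] by (simp add: mult.commute)
      then have "real (20 * m * d) \<le> real (2 * s * (t + 1))" by (intro of_nat_mono) simp
      then have "10 * real m * d / s \<le> t + 1" using s by (simp add: field_simps)
      moreover have "1 \<le> 5 * real m * d / s"
        using of_nat_mono[OF md, where 'a=real] s by (simp add: field_simps)
      moreover have "10 * real m * d / s = 5 * real m * d / s + 5 * real m * d / s" by simp
      ultimately show ?thesis by linarith
    qed
    have tle: "t \<le> 20 * m * d" unfolding t_def by (rule div_le_dividend)
    have t0: "0 < t"
    proof -
      have "0 < 5 * real m * d / s" using m d0 s by simp
      then show ?thesis using tge by linarith
    qed
    define \<xi> where "\<xi> z y = (SOME x. x \<in> L z \<and> (x, y) \<in> E)" for z y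
    have \<xi>: "\<xi> z y \<in> L z \<and> (\<xi> z y, y) \<in> E" if "z \<in> I" "y \<in> T z" for z y
    proof -
      have "E `` {y} \<inter> L z \<noteq> {}" using T(1)[OF that(1)] that(2) by auto
      then have "\<exists>x. x \<in> L z \<and> (x, y) \<in> E" using symE by (auto simp: sym_def)
      then show ?thesis unfolding \<xi>_def by (rule someI_ex)
    qed
    have coll: "16 * real (40 * m) * (\<Sum>y\<in>T z. \<Sum>y'\<in>T z - {y}.
        card (N y \<inter> N y') / (real (card (N y)) * card (N y'))) \<le> t / 4" if z: "z \<in> I" for z
    proof -
      have TY: "T z \<subseteq> Y" using T(1)[OF z] by auto
      have "16 * real (40 * m) * (\<Sum>y\<in>T z. \<Sum>y'\<in>T z - {y}.
          card (N y \<inter> N y') / (real (card (N y)) * card (N y'))) \<le> card (T z) / 4"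
      proof (rule collision_weight_le[OF fin(1) _ _ s _ F2, where k=k])
        show "finite (T z)" using TY fin by (auto intro: finite_subset)
        show "0 < 40 * m" using m by simp
        show "N y \<subseteq> X \<and> d \<le> card (N y)" if "y \<in> T z" for y
          using degY[of y] that TY by (auto simp: N_def)
        show "card {e \<in> X. \<forall>y\<in>A. e \<in> N y} \<le> k" if "A \<subseteq> T z" "card A = s" for A
        proof -
          have "{e \<in> X. \<forall>y\<in>A. e \<in> N y} = {e \<in> X. A \<subseteq> E `` {e}}"
            using symE by (auto simp: N_def sym_def)
          then show ?thesis using free_subset[of A X] that TY XY by auto
        qed
        \<comment> \<open>The collision bound contributes one factor \<open>m\<close> and the size
          of \<open>T z\<close> another, each to the power \<open>s - 1\<close>. This produces the
          exponent \<open>2 * (s - 1)\<close> in \<open>large\<close> and thus the exponent of the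
          theorem.\<close>
        have "real t ^ (s - 1) \<le> (20 * real m * d) ^ (s - 1)"
          using of_nat_mono[OF tle, where 'a=real] by (intro power_mono) auto
        then have "(128 * real (40 * m)) ^ (s - 1) * real s ^ s * k * real t ^ (s - 1)
            \<le> (128 * real (40 * m)) ^ (s - 1) * real s ^ s * k * (20 * real m * d) ^ (s - 1)"
          by (intro mult_left_mono) auto
        also have "\<dots> = ((128 * real (40 * m)) * (20 * m)) ^ (s - 1) * (real s ^ s * k) * real d ^ (s - 1)"
          by (simp only: power_mult_distrib of_nat_mult of_nat_numeral mult_ac)
        also have "(128 * real (40 * m)) * (20 * m) = 102400 * real m ^ 2"
          by (simp add: power2_eq_square)
        also have "(102400 * real m ^ 2) ^ (s - 1) * (real s ^ s * k) * real d ^ (s - 1)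
            = real (102400 ^ (s - 1) * s ^ s * k * m ^ (2 * (s - 1))) * real d ^ (s - 1)"
          by (simp add: power_mult_distrib power_mult mult_ac)
        also have "\<dots> \<le> real d * real d ^ (s - 1)"
          using large by (intro mult_right_mono of_nat_mono) auto
        also have "\<dots> = real d ^ s" using s by (cases s) auto
        finally show "(128 * real (40 * m)) ^ (s - 1) * real s ^ s * k * real (card (T z)) ^ (s - 1) \<le> real d ^ s"
          using T(2)[OF z] by simp
      qed
      then show ?thesis using T(2)[OF z] by simp
    qed
    have "\<exists>C g H. C \<subseteq> X \<and> C \<noteq> {} \<and> real (40 * m) * card C \<le> 4 * card X \<and> H \<subseteq> Y - Z \<and> (\<forall>y\<in>H. g y \<in> N y \<inter> C) \<and>
      real (card I) * t / 4 \<le> (\<Sum>i\<in>I. real (card (g ` {y \<in> T i \<inter> H. \<xi> i y \<notin> C})))"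
    proof (rule grouping[OF fin(1) _ finI XY(4) I0 t0 _ _ _ _ _ coll])
      show "finite (Y - Z)" using fin by simp
      show "N y \<subseteq> X \<and> d \<le> card (N y)" if "y \<in> Y - Z" for y
        using degY[of y] that by (auto simp: N_def)
      show "T i \<subseteq> Y - Z \<and> card (T i) = t" if "i \<in> I" for i using T[OF that] by auto
      show "\<xi> i y \<in> X" if "i \<in> I" "y \<in> T i" for i y using \<xi>[OF that] LX[OF that(1)] by auto
      show "40 \<le> 40 * m" "160 * (40 * m) \<le> d" using m1 ds by linarith+
    qed
    then obtain C g H where C: "C \<subseteq> X" "C \<noteq> {}" "real (40 * m) * card C \<le> 4 * card X"
      and H: "H \<subseteq> Y - Z" "\<And>y. y \<in> H \<Longrightarrow> g y \<in> N y \<inter> C"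
      and many: "real (card I) * t / 4 \<le> (\<Sum>i\<in>I. real (card (g ` {y \<in> T i \<inter> H. \<xi> i y \<notin> C})))"
      by blast
    define P where "P = I \<union> C"
    \<comment> \<open>Leaves that have become centres are removed from the stars in
      \<open>I\<close>; a centre in \<open>C\<close> receives the vertices of \<open>H\<close>
      assigned to it. As \<open>H\<close> avoids \<open>Z\<close>, the two kinds of stars do not
      meet.\<close>
    define b where "b c = (if c \<in> I then insert c (L c - C) else insert c {y \<in> H. g y = c})" for c
    have IY: "I \<subseteq> Y" "I \<subseteq> Z" using Z by (auto simp: I_def)
    have IC: "I \<inter> C = {}" using IY C XY by auto
    have finC: "finite C" using C fin by (auto intro: finite_subset)
    have bI: "b c = insert c (L c - C)" if "c \<in> I" for c using that by (simp add: b_def)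
    have bC: "b c = insert c {y \<in> H. g y = c}" if "c \<in> C" for c using that IC by (auto simp: b_def)
    let ?A = "{(c, e). c \<in> P \<and> e \<in> P \<and> c \<noteq> e \<and> (\<exists>x\<in>b c. \<exists>y\<in>b e. (x, y) \<in> E)}"
    have finA: "finite ?A" by (rule finite_subset[of _ "P \<times> P"]) (use finI finC in \<open>auto simp: P_def\<close>)
    \<comment> \<open>The density of \<open>C\<close> is at most 1 / (10 m) in \<open>X\<close>, and
      |X| \<le> 80 m |Z|.\<close>
    have cardC: "real (card C) \<le> 8 * card Z"
    proof -
      have "40 * real m * card C \<le> 4 * (80 * real m * card Z)"
        using C(3) of_nat_mono[OF XZ, where 'a=real] by simp
      then have "(40 * real m) * card C \<le> (40 * real m) * (8 * card Z)" by simp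
      then show ?thesis using m by simp
    qed
    \<comment> \<open>There are at most 9 |Z| branch sets, while at least 3/4 |Z| stars see t / 4 of
      them on average; with t \<ge> 5 m d / s this leaves room to spare.\<close>
    have "m * d / (16 * s) * card P \<le> m * d / (16 * s) * (9 * real (card Z))"
    proof -
      have "card P \<le> card I + card C" unfolding P_def by (rule card_Un_le)
      moreover have "card I \<le> card Z" using IY finZ by (intro card_mono)
      ultimately have "real (card P) \<le> 9 * real (card Z)" using cardC by linarith
      then show ?thesis by (intro mult_left_mono) auto
    qed
    also have "\<dots> = 9 / 80 * (5 * real m * d / s) * card Z" by simp
    also have "\<dots> \<le> 3 / 16 * (5 * real m * d / s) * card Z"
      by (intro mult_right_mono) auto
    also have "\<dots> \<le> 3 / 16 * real t * card Z"
      using tge by (intro mult_right_mono mult_left_mono) auto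
    also have "\<dots> \<le> real (card I) * t / 4"
    proof -
      have "3 * real (card Z) \<le> 4 * real (card I)" using of_nat_mono[OF IZ, where 'a=real] by simp
      then have "t * (3 * real (card Z)) \<le> t * (4 * real (card I))" by (intro mult_left_mono) auto
      then show ?thesis by (simp add: mult_ac)
    qed
    also note many
    also have "(\<Sum>i\<in>I. real (card (g ` {y \<in> T i \<inter> H. \<xi> i y \<notin> C})))
        = card (SIGMA i:I. g ` {y \<in> T i \<inter> H. \<xi> i y \<notin> C})"
    proof -
      have "finite (g ` {y \<in> T i \<inter> H. \<xi> i y \<notin> C})" for i
        using H(1) fin by (auto intro: finite_subset)
      then show ?thesis using finI by simp
    qed
    also have "\<dots> \<le> card ?A"
    proof (intro of_nat_mono card_mono finA subsetI)
      fix p assume "p \<in> (SIGMA i:I. g ` {y \<in> T i \<inter> H. \<xi> i y \<notin> C})"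
      then obtain i y where p: "p = (i, g y)" "i \<in> I" "y \<in> T i" "y \<in> H" "\<xi> i y \<notin> C" by auto
      \<comment> \<open>The edge from the leaf \<open>\<xi> i y\<close> to \<open>y\<close> joins
        star \<open>i\<close> to the star that contains \<open>y\<close>.\<close>
      have "g y \<in> C" using H(2)[OF p(4)] by auto
      moreover have "\<xi> i y \<in> b i" using \<xi>[OF p(2,3)] p by (simp add: bI)
      moreover have "y \<in> b (g y)" using \<open>g y \<in> C\<close> p by (simp add: bC)
      ultimately show "p \<in> ?A" using p IC \<xi>[OF p(2,3)] by (auto simp: P_def)
    qed
    finally have le: "m * d / (16 * s) * card P \<le> card ?A" .
    have YX: "y \<notin> X" if "y \<in> Y" for y using that XY by auto
    have "b c \<inter> b e = {}" if ce: "c \<in> P" "e \<in> P" "c \<noteq> e" for c e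
    proof -
      have II: "b c \<inter> b e = {}" if "c \<in> I" "e \<in> I" "c \<noteq> e" for c e
      proof -
        have "S c \<inter> S e = {}" using disj that IZ' by (auto simp: disjoint_family_on_def)
        then have "L c \<inter> L e = {}" using L(1) that by blast
        moreover have "c \<notin> L e" "e \<notin> L c" using LX that IY YX by blast+
        ultimately show ?thesis using that by (auto simp: bI)
      qed
      have IC': "b c \<inter> b e = {}" if "c \<in> I" "e \<in> C" for c e
      proof -
        have "c \<notin> H" using that IY H(1) by auto
        moreover have "H \<inter> L c = {}" using H(1) LX[OF that(1)] YX by blast
        ultimately show ?thesis using that IC by (auto simp: bI bC)
      qed
      have CC: "b c \<inter> b e = {}" if "c \<in> C" "e \<in> C" "c \<noteq> e" for c e
      proof -
        have "c \<notin> H" "e \<notin> H" using that C(1) H(1) YX by blast+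
        then show ?thesis using that by (auto simp: bC)
      qed
      show ?thesis using ce II IC' CC unfolding P_def by blast
    qed
    then have "disjoint_family_on b P" by (simp add: disjoint_family_on_def)
    moreover have "c \<in> b c \<and> b c \<subseteq> insert c (E `` {c})" if "c \<in> P" for c
    proof (cases "c \<in> I")
      case True
      have "L c \<subseteq> E `` {c}" using L(1)[OF True] S(1)[OF IZ'[OF True]] by (auto simp: N_def)
      then show ?thesis by (auto simp: bI[OF True])
    next
      case False
      then have "c \<in> C" using that by (simp add: P_def)
      have "(c, y) \<in> E" if "y \<in> H" "g y = c" for y
        using H(2)[OF that(1)] that(2) symE by (auto simp: N_def sym_def)
      then show ?thesis by (auto simp: bC[OF \<open>c \<in> C\<close>])
    qed
    moreover have "P \<subseteq> V" "P \<noteq> {}" using IY C XY by (auto simp: P_def)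
    ultimately show ?thesis
      unfolding has_star_minor_def using le by (intro exI[of _ P] exI[of _ b]) blast
  qed
qed

end

section \<open>Reduction to bipartite graphs and choice of the star size\<close>

text \<open>A random 2-colouring makes half of the arcs bichromatic on average. By symmetry half of
  those go from \<open>A\<close> to its complement, so a quarter of all arcs remains.\<close>

lemma exists_large_cut:
  fixes E :: "'a rel"
  assumes fin: "finite V" and E: "E \<subseteq> V \<times> V" "sym E" "irrefl E"
  shows "\<exists>A\<subseteq>V. card E \<le> 4 * card (E \<inter> A \<times> (V - A))"
proof -
  have finE: "finite E" using fin E by (auto intro: finite_subset)
  have sumE: "(\<Sum>x\<in>V. \<Sum>y\<in>V - {x}. of_bool ((x, y) \<in> E) * h x y) = (\<Sum>(x, y)\<in>E. h x y)"
    for h :: "'a \<Rightarrow> 'a \<Rightarrow> real"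
  proof -
    have "(\<Sum>x\<in>V. \<Sum>y\<in>V - {x}. of_bool ((x, y) \<in> E) * h x y)
        = (\<Sum>(x, y)\<in>(SIGMA x:V. V - {x}). of_bool ((x, y) \<in> E) * h x y)"
      using fin by (intro sum.Sigma) auto
    also have "\<dots> = (\<Sum>(x, y)\<in>E. h x y)"
      using fin E by (intro sum.mono_neutral_cong_right) (auto simp: irrefl_def)
    finally show ?thesis .
  qed
  obtain g :: "'a \<Rightarrow> nat" where g: "\<forall>x\<in>V. g x \<in> {..<2}"
    and le: "(\<Sum>x\<in>V. \<Sum>y\<in>V - {x}. of_bool ((x, y) \<in> E) * of_bool (g x = g y))
      \<le> (\<Sum>x\<in>V. \<Sum>y\<in>V - {x}. of_bool ((x, y) \<in> E) * (1 / 2 :: real))"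
    using averaging_choice[OF fin, of "\<lambda>_. {..<2::nat}" "\<lambda>_ _. 0" "\<lambda>x y. of_bool ((x, y) \<in> E)"]
    by (auto simp: lessThan_empty_iff)
  define A where "A = {x \<in> V. g x = 0}"
  define R where "R = E \<inter> A \<times> (V - A)"
  have mono: "card {(x, y) \<in> E. g x = g y} \<le> real (card E) / 2"
  proof -
    have "(\<Sum>(x, y)\<in>E. of_bool (g x = g y) :: real) = card {(x, y) \<in> E. g x = g y}"
      using finE by (simp add: case_prod_unfold Collect_conj_eq)
    then show ?thesis using le unfolding sumE by simp
  qed
  have "E \<subseteq> {(x, y) \<in> E. g x = g y} \<union> (R \<union> R\<inverse>)"
  proof
    fix p assume p: "p \<in> E"
    then obtain x y where xy: "p = (x, y)" "x \<in> V" "y \<in> V" "(y, x) \<in> E" using E by (auto simp: sym_def)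
    have "g x < 2" "g y < 2" using g xy by auto
    then show "p \<in> {(x, y) \<in> E. g x = g y} \<union> (R \<union> R\<inverse>)"
      using p xy by (auto simp: R_def A_def)
  qed
  moreover have finR: "finite R" using finE by (simp add: R_def)
  ultimately have "card E \<le> card ({(x, y) \<in> E. g x = g y} \<union> (R \<union> R\<inverse>))"
    using finE by (intro card_mono) (auto intro: finite_subset)
  also have "\<dots> \<le> card {(x, y) \<in> E. g x = g y} + (card R + card (R\<inverse>))"
    using card_Un_le[of "{(x, y) \<in> E. g x = g y}" "R \<union> R\<inverse>"] card_Un_le[of R "R\<inverse>"] by linarith
  finally have "card E \<le> card {(x, y) \<in> E. g x = g y} + 2 * card R"
    by (simp add: card_inverse)
  then have "card E \<le> 4 * card R" using mono by linarith
  then show ?thesis unfolding R_def by (intro exI[of _ A]) (auto simp: A_def)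
qed

text \<open>The cut keeps at least 4 d |V| arcs, and the two thresholds \<open>2 * d\<close> cost
  only 2 d |V|. The larger side of the core plays the role of \<open>X\<close>.\<close>

lemma (in sparse_graph) star_minor:
  fixes m d :: nat
  assumes "irrefl E" "V \<noteq> {}" and dense: "16 * d * card V \<le> card E"
    and m: "0 < m" and large: "102400 ^ (s - 1) * s ^ s * k * m ^ (2 * (s - 1)) \<le> d"
  shows "has_star_minor E V (m * d / (16 * s))"
proof -
  obtain A where A: "A \<subseteq> V" "card E \<le> 4 * card (E \<inter> A \<times> (V - A))"
    using exists_large_cut[OF finV E symE] assms by blast
  define R where "R = E \<inter> A \<times> (V - A)"
  have "0 < 102400 ^ (s - 1) * s ^ s * k * m ^ (2 * (s - 1))" using s k m by simp
  then have d0: "0 < d" using large by linarith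
  have V0: "0 < card V" using assms finV by (simp add: card_gt_0_iff)
  have cV: "card A + card (V - A) = card V"
    using A finV by (simp add: card_Diff_subset finite_subset card_mono)
  have fin: "finite A" "finite (V - A)" using A finV by (auto intro: finite_subset)
  have Rsub: "R \<subseteq> A \<times> (V - A)" by (auto simp: R_def)
  have d2: "0 \<le> 2 * real d" by simp
  have Rcard: "2 * real d * card A + 2 * real d * card (V - A) < card R"
  proof -
    have "2 * d * card A + 2 * d * card (V - A) = 2 * d * card V"
      by (simp flip: cV add: distrib_left)
    also have "\<dots> < 4 * d * card V" using d0 V0 by simp
    also have "\<dots> \<le> card R" using dense A(2) by (simp add: R_def)
    finally have "real (2 * d * card A + 2 * d * card (V - A)) < real (card R)" by (simp only: of_nat_less_iff)
    then show ?thesis by simp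
  qed
  obtain X Y where XY: "X \<subseteq> A" "Y \<subseteq> V - A" "X \<noteq> {}" "Y \<noteq> {}"
    and dX: "\<And>x. x \<in> X \<Longrightarrow> 2 * real d \<le> card (R `` {x} \<inter> Y)"
    and dY: "\<And>y. y \<in> Y \<Longrightarrow> 2 * real d \<le> card (R\<inverse> `` {y} \<inter> X)"
    using bipartite_min_degree_core[OF fin Rsub d2 d2 Rcard] by blast
  have finXY: "finite X" "finite Y" using XY fin by (auto intro: finite_subset)
  have degX: "2 * d \<le> card (E `` {x} \<inter> Y)" if "x \<in> X" for x
  proof -
    have "card (R `` {x} \<inter> Y) \<le> card (E `` {x} \<inter> Y)"
      using finXY by (intro card_mono) (auto simp: R_def)
    then show ?thesis using dX[OF that] by linarith
  qed
  have degY: "2 * d \<le> card (E `` {y} \<inter> X)" if "y \<in> Y" for y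
  proof -
    have "card (R\<inverse> `` {y} \<inter> X) \<le> card (E `` {y} \<inter> X)"
      using finXY symE by (intro card_mono) (auto simp: R_def sym_def)
    then show ?thesis using dY[OF that] by linarith
  qed
  have sub: "X \<subseteq> V" "Y \<subseteq> V" "X \<inter> Y = {}" "Y \<inter> X = {}" using XY A by auto
  show ?thesis
  proof (cases "card Y \<le> card X")
    case True
    then show ?thesis using star_minor_of_bipartite[OF sub(1,2,3) XY(3) _ degX degY m large] by blast
  next
    case False
    then show ?thesis using star_minor_of_bipartite[OF sub(2,1,4) XY(4) _ degY degX m large] by simp
  qed
qed

text \<open>Take the integer part of (d / K)^\<alpha>. Since d \<ge> K it is at least 1, so rounding
  down costs at most a factor 2.\<close>

lemma exists_root_scale:
  fixes K d s :: nat and \<alpha> :: real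
  assumes "2 \<le> s" "0 < K" "K \<le> d" and \<alpha>: "\<alpha> = 1 / (2 * (real s - 1))"
  shows "\<exists>m>0. K * m ^ (2 * (s - 1)) \<le> d \<and> (d / K) powr \<alpha> / 2 \<le> m"
proof -
  define x where "x = real d / K"
  define m where "m = nat \<lfloor>x powr \<alpha>\<rfloor>"
  have x1: "1 \<le> x" using assms by (simp add: x_def)
  have a0: "0 \<le> \<alpha>" using assms by simp
  have p1: "1 \<le> x powr \<alpha>" using x1 a0 by (rule ge_one_powr_ge_zero)
  have mle: "real m \<le> x powr \<alpha>" and mgt: "x powr \<alpha> < m + 1"
    using p1 by (auto simp: m_def) linarith+
  have m0: "0 < m" using p1 mgt by (cases m) auto
  have "real m ^ (2 * (s - 1)) \<le> (x powr \<alpha>) ^ (2 * (s - 1))"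
    using mle by (intro power_mono) auto
  also have "\<dots> = x powr (\<alpha> * (2 * (s - 1)))"
    using x1 by (simp add: powr_powr flip: powr_realpow)
  also have "\<alpha> * (2 * (s - 1)) = 1"
    using assms by (simp add: of_nat_diff)
  finally have "real m ^ (2 * (s - 1)) \<le> x" using x1 by simp
  then have "real (K * m ^ (2 * (s - 1))) \<le> real d"
    using assms by (simp add: x_def field_simps)
  then have "K * m ^ (2 * (s - 1)) \<le> d" by (simp only: of_nat_le_iff)
  moreover have "x powr \<alpha> / 2 \<le> m"
  proof -
    have "1 \<le> real m" using m0 by simp
    then show ?thesis using mgt by linarith
  qed
  ultimately show ?thesis using m0 by (auto simp: x_def)
qed

subsection \<open>From star systems to minors\<close>

lemma card_parcs_eq:
  assumes "pair_graph G"
  shows "card (parcs G) = 2 * card (edges G)"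
proof -
  interpret pair_graph G by fact
  let ?f = "\<lambda>(u, v). {u, v}"
  have img: "edges G = ?f ` parcs G" by (force simp: edges_def)
  have "card (parcs G) = (\<Sum>e\<in>?f ` parcs G. \<Sum>p\<in>{p \<in> parcs G. ?f p = e}. 1)"
    using sum.image_gen[OF pair_finite_arcs, of "\<lambda>_. 1 :: nat" ?f] by simp
  also have "\<dots> = (\<Sum>e\<in>?f ` parcs G. 2)"
  proof (rule sum.cong[OF refl])
    fix e assume "e \<in> ?f ` parcs G"
    then obtain u v where e: "e = {u, v}" "(u, v) \<in> parcs G" by auto
    have "(v, u) \<in> parcs G" using e pair_sym_arcs by (auto simp: symmetric_def sym_def)
    moreover have "u \<noteq> v" using pair_no_loops[OF e(2)] by simp
    ultimately have "{p \<in> parcs G. ?f p = e} = {(u, v), (v, u)}"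
      using e by (auto simp: doubleton_eq_iff)
    then show "(\<Sum>p\<in>{p \<in> parcs G. ?f p = e}. 1) = (2::nat)" using \<open>u \<noteq> v\<close> by simp
  qed
  finally show ?thesis by (simp add: img)
qed

lemma average_degree_eq:
  assumes "pair_graph G"
  shows "average_degree G = card (parcs G) / card (pverts G)"
  using card_parcs_eq[OF assms] by (simp add: average_degree_def)

text \<open>Connectedness is reachability in the symmetric closure, where any two vertices are
  joined through the centre.\<close>

lemma connected_star:
  assumes "pair_graph H" "c \<in> pverts H" and star: "\<And>v. v \<in> pverts H \<Longrightarrow> v \<noteq> c \<Longrightarrow> (c, v) \<in> parcs H"
  shows "Digraph_Component.connected (with_proj H)"
proof -
  interpret H: pair_graph H by fact
  interpret S: pair_wf_digraph "mk_symmetric (with_proj H)" ..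
  have sub: "(u, v) \<in> parcs (mk_symmetric (with_proj H)) \<and> (v, u) \<in> parcs (mk_symmetric (with_proj H))"
    if "(u, v) \<in> parcs H" for u v
    using that by (auto simp: mk_symmetric_def intro!: bexI[of _ "(u, v)"])
  have 1: "c \<rightarrow>\<^sup>*\<^bsub>with_proj (mk_symmetric (with_proj H))\<^esub> v \<and>
      v \<rightarrow>\<^sup>*\<^bsub>with_proj (mk_symmetric (with_proj H))\<^esub> c" if "v \<in> pverts H" for v
  proof (cases "v = c")
    case True
    have "pverts (mk_symmetric (with_proj H)) = pverts H" by (simp add: mk_symmetric_def)
    then show ?thesis using True that S.reachable_refl[of c] by simp
  next
    case False
    then show ?thesis using sub[OF star[OF that False]] by (auto intro: S.reachable_adjI)
  qed
  show ?thesis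
  proof (rule H.connectedI)
    show "pverts H \<noteq> {}" using assms by auto
    fix u v assume "u \<in> pverts H" "v \<in> pverts H"
    then show "u \<rightarrow>\<^sup>*\<^bsub>with_proj (mk_symmetric (with_proj H))\<^esub> v"
      using 1 S.reachable_trans by blast
  qed
qed

lemma minor_of_star_minor:
  fixes G :: "'a pair_pre_digraph"
  assumes "pair_graph G" "has_star_minor (parcs G) (pverts G) \<delta>"
  shows "\<exists>\<Gamma> :: 'a pair_pre_digraph. pair_graph \<Gamma> \<and> pverts \<Gamma> \<noteq> {} \<and> is_minor \<Gamma> G \<and> \<delta> \<le> average_degree \<Gamma>"
proof -
  interpret G: pair_graph G by fact
  have symG: "(v, u) \<in> parcs G" if "(u, v) \<in> parcs G" for u v
    using that G.pair_sym_arcs by (auto simp: symmetric_def sym_def)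
  obtain P b where P: "P \<subseteq> pverts G" "P \<noteq> {}"
    and b: "\<And>c. c \<in> P \<Longrightarrow> c \<in> b c \<and> b c \<subseteq> insert c (parcs G `` {c})"
    and disj: "disjoint_family_on b P"
    and le: "\<delta> * card P \<le> card {(c, e). c \<in> P \<and> e \<in> P \<and> c \<noteq> e \<and> (\<exists>x\<in>b c. \<exists>y\<in>b e. (x, y) \<in> parcs G)}"
    using assms(2) unfolding has_star_minor_def by blast
  define \<Gamma> where "\<Gamma> = \<lparr>pverts = P,
    parcs = {(c, e). c \<in> P \<and> e \<in> P \<and> c \<noteq> e \<and> (\<exists>x\<in>b c. \<exists>y\<in>b e. (x, y) \<in> parcs G)}\<rparr>"
  \<comment> \<open>The branch sets are induced subgraphs; each contains all arcs between its centre
    and its leaves and is therefore connected.\<close>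
  define B where "B c = \<lparr>pverts = b c, parcs = parcs G \<inter> b c \<times> b c\<rparr>" for c
  have finP: "finite P" using P G.pair_finite_verts by (auto intro: finite_subset)
  have pg: "pair_graph \<Gamma>"
  proof unfold_locales
    show "finite (parcs \<Gamma>)"
      by (rule finite_subset[of _ "P \<times> P"]) (use finP in \<open>auto simp: \<Gamma>_def\<close>)
    show "symmetric (with_proj \<Gamma>)"
      using symG by (fastforce simp: \<Gamma>_def symmetric_def sym_def)
  qed (use finP in \<open>auto simp: \<Gamma>_def\<close>)
  have bG: "b c \<subseteq> pverts G" if "c \<in> P" for c
    using b[OF that] P that G.in_arcsD2 by blast
  have pB: "pair_graph (B c)" if "c \<in> P" for c
  proof unfold_locales
    show "finite (pverts (B c))" using bG[OF that] G.pair_finite_verts by (auto simp: B_def intro: finite_subset)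
    show "finite (parcs (B c))" using G.pair_finite_arcs by (simp add: B_def)
    show "symmetric (with_proj (B c))" using symG by (auto simp: B_def symmetric_def sym_def)
  qed (use G.pair_no_loops in \<open>auto simp: B_def\<close>)
  have "subgraph (with_proj (B c)) (with_proj G)" if "c \<in> P" for c
  proof -
    interpret B: pair_graph "B c" by (rule pB[OF that])
    show ?thesis
      using bG[OF that] G.wf_digraph B.wf_digraph
      by (auto simp: subgraph_def compatible_def B_def)
  qed
  moreover have "Digraph_Component.connected (with_proj (B c))" if "c \<in> P" for c
    using b[OF that] by (intro connected_star[OF pB[OF that], of c]) (auto simp: B_def)
  ultimately have "is_minor \<Gamma> G"
    unfolding is_minor_def using pB disj
    by (intro exI[of _ B]) (auto simp: \<Gamma>_def disjoint_family_on_def B_def)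
  moreover have "\<delta> \<le> average_degree \<Gamma>"
    using le P finP unfolding average_degree_eq[OF pg]
    by (simp add: \<Gamma>_def le_divide_eq card_gt_0_iff)
  ultimately show ?thesis using pg P by (intro exI[of _ \<Gamma>]) (auto simp: \<Gamma>_def)
qed

text \<open>The graph as a minor of itself, with singleton stars; it serves when the average degree
  is bounded.\<close>

lemma has_star_minor_self:
  assumes "pair_graph G" "pverts G \<noteq> {}"
  shows "has_star_minor (parcs G) (pverts G) (average_degree G)"
proof -
  interpret pair_graph G by fact
  have "{(c, e). c \<in> pverts G \<and> e \<in> pverts G \<and> c \<noteq> e \<and> (c, e) \<in> parcs G} = parcs G"
    using in_arcsD1 in_arcsD2 pair_no_loops by fastforce
  then show ?thesis
    unfolding has_star_minor_def average_degree_eq[OF assms(1)]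
    using assms by (intro exI[of _ "pverts G"] exI[of _ "\<lambda>c. {c}"]) (auto simp: disjoint_family_on_def)
qed

lemma sparse_graph_of_complete_bipartite_free:
  assumes "pair_graph G" "complete_bipartite_free s s' G" "2 \<le> s" "s \<le> s'"
  shows "sparse_graph (pverts G) (parcs G) s s'"
proof -
  interpret pair_graph G by fact
  have symG: "(v, u) \<in> parcs G" if "(u, v) \<in> parcs G" for u v
    using that pair_sym_arcs by (auto simp: symmetric_def sym_def)
  have "card {y \<in> pverts G. A \<subseteq> parcs G `` {y}} \<le> s'" if A: "A \<subseteq> pverts G" "card A = s" for A
  proof (rule ccontr)
    assume "\<not> ?thesis"
    then obtain C where C: "C \<subseteq> {y \<in> pverts G. A \<subseteq> parcs G `` {y}}" "card C = s'"
      by (meson nat_le_linear obtain_subset_with_card_n)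
    define H where "H = \<lparr>pverts = A \<union> C, parcs = A \<times> C \<union> C \<times> A\<rparr>"
    have fin: "finite A" "finite C"
      using A C(1) pair_finite_verts by (auto intro: finite_subset)
    \<comment> \<open>A common neighbour of \<open>A\<close> cannot lie in \<open>A\<close>, since
      there are no loops.\<close>
    have "A \<inter> C = {}" using C(1) pair_no_loops by fastforce
    then have K: "complete_bipartite_digraph s s' (with_proj H)"
      unfolding complete_bipartite_digraph_pair_def using fin A C
      by (intro conjI exI[of _ A] exI[of _ C]) (auto simp: H_def)
    have "(c, a) \<in> parcs G \<and> (a, c) \<in> parcs G" if "a \<in> A" "c \<in> C" for a c
      using C(1) that symG by blast
    moreover have "wf_digraph (with_proj H)"
      by unfold_locales (auto simp: H_def)
    ultimately have "subgraph (with_proj H) (with_proj G)"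
      unfolding subgraph_def compatible_def using A C(1) wf_digraph by (auto simp: H_def)
    then show False using K assms(2) unfolding complete_bipartite_free_def by blast
  qed
  then show ?thesis
    using assms symG pair_finite_verts in_arcsD1 in_arcsD2
    by unfold_locales (auto simp: sym_def)
qed

theorem theorem4p5:
  fixes s s' :: nat
  assumes "2 \<le> s" and "s \<le> s'"
  shows "\<exists>c :: real. c > 0 \<and>
    (\<forall>G :: 'a pair_pre_digraph.
       pair_graph G \<and> pverts G \<noteq> {} \<and> complete_bipartite_free s s' G \<longrightarrow>
       (\<exists>\<Gamma> :: 'a pair_pre_digraph.
          pair_graph \<Gamma> \<and> pverts \<Gamma> \<noteq> {} \<and> is_minor \<Gamma> G \<and>
          average_degree \<Gamma> \<ge> c * average_degree G powr (1 + 1 / (2 * (real s - 1)))))"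
proof -
  \<comment> \<open>\<open>K\<close> is the coefficient in the condition on \<open>m\<close> with
    \<open>k = s'\<close>. In \<open>c\<close>, 1024 is 2 * 32 * 16: rounding of \<open>m\<close>,
    the bound d \<ge> r / 32, and the 16 of the star minor.\<close>
  define K where "K = 102400 ^ (s - 1) * s ^ s * s'"
  define \<alpha> where "\<alpha> = 1 / (2 * (real s - 1))"
  define c where "c = 1 / (1024 * s * (32 * real K) powr \<alpha>)"
  have K0: "0 < K" using assms by (simp add: K_def)
  have a0: "0 \<le> \<alpha>" using assms by (simp add: \<alpha>_def)
  have c0: "0 < c" using assms K0 by (simp add: c_def)
  have "\<exists>\<Gamma> :: 'a pair_pre_digraph. pair_graph \<Gamma> \<and> pverts \<Gamma> \<noteq> {} \<and> is_minor \<Gamma> G \<and>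
      c * average_degree G powr (1 + \<alpha>) \<le> average_degree \<Gamma>"
    if G: "pair_graph G" "pverts G \<noteq> {}" "complete_bipartite_free s s' G" for G :: "'a pair_pre_digraph"
  proof -
    interpret pair_graph G by (rule G(1))
    interpret sparse_graph "pverts G" "parcs G" s s'
      by (rule sparse_graph_of_complete_bipartite_free[OF G(1,3) assms])
    define r where "r = average_degree G"
    have r0: "0 \<le> r" by (simp add: r_def average_degree_def)
    have rpowr: "r powr (1 + \<alpha>) = r * r powr \<alpha>"
      using r0 a0 by (cases "r = 0") (auto simp: powr_add)
    have "\<exists>\<delta>. has_star_minor (parcs G) (pverts G) \<delta> \<and> c * r powr (1 + \<alpha>) \<le> \<delta>"
    \<comment> \<open>Below the threshold \<open>r powr \<alpha>\<close> is bounded, and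
      \<open>c\<close> is small enough for the graph itself to do. Above it, d \<ge> K permits a
      positive \<open>m\<close>.\<close>
    proof (cases "r < 16 * real K")
      case True
      have "r powr \<alpha> \<le> 1 * (32 * real K) powr \<alpha>"
        unfolding mult_1 using True r0 a0 by (intro powr_mono2) auto
      also have "\<dots> \<le> 1024 * s * (32 * real K) powr \<alpha>"
        using assms by (intro mult_right_mono) auto
      finally have "c * r powr \<alpha> \<le> 1"
        using assms K0 by (simp add: c_def divide_le_eq)
      then have "r * (c * r powr \<alpha>) \<le> r * 1" using r0 by (intro mult_left_mono)
      then have "c * r powr (1 + \<alpha>) \<le> r" unfolding rpowr by (simp add: mult_ac)
      then show ?thesis using has_star_minor_self[OF G(1,2)] by (auto simp: r_def)
    next
      case False
      \<comment> \<open>The number of arcs is r |V|, so this is the largest integer \<open>d\<close>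
        meeting the density condition 16 d |V| \<le> r |V|.\<close>
      define d where "d = nat \<lfloor>r / 16\<rfloor>"
      have dle: "real d \<le> r / 16" and dgt: "r / 16 < real d + 1"
        using r0 by (auto simp: d_def) linarith+
      have Kd: "K \<le> d"
      proof -
        have "real K \<le> r / 16" using False by simp
        then have "int K \<le> \<lfloor>r / 16\<rfloor>" by (simp add: le_floor_iff)
        then show ?thesis by (simp add: d_def)
      qed
      then have dr: "r / 32 \<le> d" using K0 dgt by linarith
      obtain m where m: "0 < m" "K * m ^ (2 * (s - 1)) \<le> d" "(d / K) powr \<alpha> / 2 \<le> m"
        using exists_root_scale[OF assms(1) K0 Kd \<alpha>_def] by blast
      have "16 * d * card (pverts G) \<le> card (parcs G)"
      proof -
        have "16 * real d * card (pverts G) \<le> r * card (pverts G)"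
          using dle by (intro mult_right_mono) auto
        also have "\<dots> = card (parcs G)"
          using G(2) by (simp add: r_def average_degree_eq[OF G(1)] pair_finite_verts)
        finally have "real (16 * d * card (pverts G)) \<le> real (card (parcs G))" by simp
        then show ?thesis by (simp only: of_nat_le_iff)
      qed
      moreover have "irrefl (parcs G)" using pair_no_loops by (force simp: irrefl_def)
      ultimately have "has_star_minor (parcs G) (pverts G) (m * d / (16 * s))"
        using G(2) m by (intro star_minor) (simp_all add: K_def)
      moreover have "c * r powr (1 + \<alpha>) \<le> m * d / (16 * s)"
      proof -
        have "r powr \<alpha> / (32 * real K) powr \<alpha> = (r / (32 * real K)) powr \<alpha>"
          using r0 by (simp add: powr_divide)
        also have "\<dots> \<le> (d / K) powr \<alpha>"
          using dr r0 a0 K0 by (intro powr_mono2) (auto simp: field_simps)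
        finally have "r powr \<alpha> / (32 * real K) powr \<alpha> / 2 \<le> (d / K) powr \<alpha> / 2"
          by (intro divide_right_mono) auto
        also note m(3)
        finally have "r powr \<alpha> / (32 * real K) powr \<alpha> / 2 \<le> m" .
        then have "(r powr \<alpha> / (32 * real K) powr \<alpha> / 2) * (r / 32) \<le> real m * d"
          using dr r0 by (intro mult_mono) auto
        then have "(r powr \<alpha> / (32 * real K) powr \<alpha> / 2) * (r / 32) / (16 * s) \<le> real m * d / (16 * s)"
          by (intro divide_right_mono) auto
        then show ?thesis unfolding rpowr c_def by (simp add: mult_ac)
      qed
      ultimately show ?thesis by blast
    qed
    then obtain \<delta> where \<delta>: "has_star_minor (parcs G) (pverts G) \<delta>" "c * r powr (1 + \<alpha>) \<le> \<delta>" by blast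
    show ?thesis
      using minor_of_star_minor[OF G(1) \<delta>(1)] \<delta>(2) unfolding r_def by (meson order_trans)
  qed
  then show ?thesis using c0 unfolding \<alpha>_def by (intro exI[of _ c]) blast
qed

end
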